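(* Let $G$ be a compact Lie group equipped with a probability density $\nu$ (twice continuously differentiable, with respect to the normalized Haar measure $dg$), let $\rho: G \to \mathrm{GL}(V)$ be an irreducible finite-dimensional complex representation, and let $W_{l_1},\dots,W_{l_q}: G\to\mathbb{C}$ be a collection of single-argument Wilson loops with respect to $\rho$. Let $\lambda\in\mathbb{C}$ be the eigenvalue of the Casimir, $\rho(C)=\sum_a\rho(\xi^a)\rho(\xi^a)=\lambda\,\mathrm{id}_V$, and let $n_r$ be the number of factors $g^{\pm1}$ in the loop $W_{l_r}$ (the length of $l_r$). Then $$\begin{aligned}\lambda \sum_{r=1}^q n_r \int_G W_{l_1}\cdots W_{l_q}\,\nu\,dg ={}& -2\sum_{1\le r<s\le q}\int_G \mathcal{M}(W_{l_r},W_{l_s})\prod_{k\ne r,s}W_{l_k}\,\nu\,dg\\ &-\sum_{r=1}^q\int_G\mathcal{T}(W_{l_r})\prod_{k\neq r}W_{l_k}\,\nu\,dg+\int_G W_{l_1}\cdots W_{l_q}\,\Delta\nu\,dg,\end{aligned}$$ where $\mathcal{M}$ denotes the total merger and $\mathcal{T}$ the total twisting.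
   Context: Setting: $G$ is a compact Lie group with Lie algebra $\mathfrak g$, $\kappa$ is a fixed $\mathrm{Ad}_G$-invariant positive-definite symmetric bilinear form on $\mathfrak g$, and $\{\xi^a\}$ is a $\kappa$-orthonormal basis of $\mathfrak g$, also viewed as left-invariant vector fields on $G$. $dg$ is the normalized Haar measure. The Laplace–Beltrami operator is $\Delta f=\sum_a\xi^a(\xi^a f)$ (so $\Delta\le0$). $C=\sum_a\xi^a\xi^a\in \mathrm{U}(\mathfrak g)$ is the Casimir invariant. The induced Lie algebra representation is also denoted $\rho$. Wilson loops: for $l=((c_1,\sigma_1),\dots,(c_n,\sigma_n))\in(G\times\{\pm1\})^n$, the single-argument Wilson loop is $W_l(g)=\mathrm{tr}\,\rho(c_1g^{\sigma_1}c_2g^{\sigma_2}\cdots c_ng^{\sigma_n})$. For positions $a,b\in\{1,\dots,n\}$ put, with indices read cyclically modulo $n$, $$P^l_{a,b}(g)=\rho\bigl(c_{a+1}\,g^{\sigma_{a+1}}\,c_{a+2}\,g^{\sigma_{a+2}}\cdots g^{\sigma_{b-1}}\,c_b\bigr),$$ going once cyclically from $a+1$ to $b$ (a full cycle if $a=b$). Thus $W_l(g)=\mathrm{tr}(P^l_{j,j}(g)\rho(g^{\sigma_j}))$ for every $j$, and $W_l(g)=\mathrm{tr}(P^l_{j',j}(g)\rho(g^{\sigma_j})P^l_{j,j'}(g)\rho(g^{\sigma_{j'}}))$ for $j\ne j'$. Put $X_a^{+1}(g)=\rho(g)\rho(\xi^a)$ and $X_a^{-1}(g)=-\rho(\xi^a)\rho(g^{-1})$.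 Merging: for loops $l,l'$ of lengths $n,n'$ (signs $\sigma,\sigma'$), $\mathcal M_{jj'}(W_l,W_{l'})(g)=\sum_a\mathrm{tr}\bigl(P^l_{j,j}(g)X_a^{\sigma_j}(g)\bigr)\,\mathrm{tr}\bigl(P^{l'}_{j',j'}(g)X_a^{\sigma'_{j'}}(g)\bigr)$, and the total merger is $\mathcal M(W_l,W_{l'})=\sum_{j=1}^{n}\sum_{j'=1}^{n'}\mathcal M_{jj'}(W_l,W_{l'})$. Twisting: for $j\ne j'$, $\mathcal T_{jj'}(W_l)(g)=\sum_a\mathrm{tr}\bigl(P^l_{j',j}(g)X_a^{\sigma_j}(g)P^l_{j,j'}(g)X_a^{\sigma_{j'}}(g)\bigr)$, and the total twisting is $\mathcal T(W_l)=\sum_{j\neq j'}\mathcal T_{jj'}(W_l)$, the sum running over ordered pairs of distinct positions. *)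

theory Defs
  imports "HOL-Probability.Probability" "HOL-Algebra.Group"
begin

section \<open>Smooth manifolds and Lie groups\<close>

text \<open>Only meant for open \<open>S\<close> and a finite-dimensional domain, where continuity of every directional
  derivative is the same as continuity of the derivative in operator norm.\<close>

primrec Ck_on :: "nat \<Rightarrow> 'a set \<Rightarrow> ('a::real_normed_vector \<Rightarrow> 'b::real_normed_vector) \<Rightarrow> bool" where
  "Ck_on 0 S f \<longleftrightarrow> continuous_on S f"
| "Ck_on (Suc k) S f \<longleftrightarrow>
     (\<exists>f'. (\<forall>x\<in>S. (f has_derivative f' x) (at x)) \<and> (\<forall>v. Ck_on k S (\<lambda>x. f' x v)))"

text \<open>A chart is a pair of its domain and the coordinate map, which is relevant only on the domain.\<close>

type_synonym ('g, 'e) chart = "'g set \<times> ('g \<Rightarrow> 'e)"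

definition smooth_atlas ::
  "('g::topological_space, 'e::real_normed_vector) chart set \<Rightarrow> bool" where
  "smooth_atlas A \<longleftrightarrow>
     (\<forall>(U, \<phi>)\<in>A. open U \<and> open (\<phi> ` U) \<and> homeomorphism U (\<phi> ` U) \<phi> (inv_into U \<phi>)) \<and>
     (\<Union>(U, \<phi>)\<in>A. U) = UNIV \<and>
     (\<forall>(U, \<phi>)\<in>A. \<forall>(V, \<psi>)\<in>A. \<forall>k. Ck_on k (\<phi> ` (U \<inter> V)) (\<psi> \<circ> inv_into U \<phi>))"

definition prod_atlas ::
  "('g, 'e) chart set \<Rightarrow> ('h, 'f) chart set \<Rightarrow> ('g \<times> 'h, 'e \<times> 'f) chart set" where
  "prod_atlas A B = {(U \<times> V, map_prod \<phi> \<psi>) |U \<phi> V \<psi>. (U, \<phi>) \<in> A \<and> (V, \<psi>) \<in> B}"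

definition vector_space_atlas :: "('v, 'v) chart set" where
  "vector_space_atlas = {(UNIV, id)}"

definition Ck_map ::
  "nat \<Rightarrow> ('g::topological_space, 'e::real_normed_vector) chart set \<Rightarrow>
   ('h::topological_space, 'f::real_normed_vector) chart set \<Rightarrow> ('g \<Rightarrow> 'h) \<Rightarrow> bool" where
  "Ck_map k A B f \<longleftrightarrow> continuous_on UNIV f \<and>
     (\<forall>(U, \<phi>)\<in>A. \<forall>(V, \<psi>)\<in>B. Ck_on k (\<phi> ` (U \<inter> f -` V)) (\<psi> \<circ> f \<circ> inv_into U \<phi>))"

definition smooth_map ::
  "('g::topological_space, 'e::real_normed_vector) chart set \<Rightarrow>
   ('h::topological_space, 'f::real_normed_vector) chart set \<Rightarrow> ('g \<Rightarrow> 'h) \<Rightarrow> bool" where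
  "smooth_map A B f \<longleftrightarrow> (\<forall>k. Ck_map k A B f)"

text \<open>The model space \<open>'e\<close> is a finite-dimensional Euclidean vector space. The class
  \<open>euclidean_space\<close> is not used because it forces positive dimension and would exclude the
  zero-dimensional (that is, finite) compact Lie groups.\<close>

locale compact_lie_group = group G
  for G :: "('g::{t2_space, second_countable_topology}, 'm) monoid_scheme" (structure) +
  fixes A :: "('g, 'e::real_inner) chart set"
  assumes carrier_UNIV: "carrier G = UNIV"
    and finite_dim: "\<exists>B::'e set. finite B \<and> span B = UNIV"
    and atlas: "smooth_atlas A"
    and smooth_mult: "smooth_map (prod_atlas A A) A (\<lambda>(x, y). x \<otimes> y)"
    and smooth_inv: "smooth_map A A (\<lambda>x. inv x)"
    and compact_UNIV: "compact (UNIV :: 'g set)"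

definition normalized_haar ::
  "('g::topological_space, 'm) monoid_scheme \<Rightarrow> 'g measure \<Rightarrow> bool" where
  "normalized_haar G M \<longleftrightarrow> sets M = sets borel \<and> prob_space M \<and>
     (\<forall>g\<in>carrier G. \<forall>S\<in>sets M. emeasure M ((\<lambda>x. g \<otimes>\<^bsub>G\<^esub> x) ` S) = emeasure M S)"


section \<open>The Lie algebra\<close>

text \<open>The Lie algebra is the tangent space at \<open>\<one>\<close>, whose elements are given by their coordinate
  vectors \<open>v :: 'e\<close> with respect to a chart \<open>c\<close> around \<open>\<one>\<close>. The tangent vector with coordinates \<open>v\<close>
  is the velocity at \<open>t = 0\<close> of the following curve, which is meaningful for small \<open>t\<close>.\<close>

definition tangent_curve ::
  "('g, 'm) monoid_scheme \<Rightarrow> ('g, 'e::real_vector) chart \<Rightarrow> 'e \<Rightarrow> real \<Rightarrow> 'g" where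
  "tangent_curve G c v t = inv_into (fst c) (snd c) (snd c \<one>\<^bsub>G\<^esub> + t *\<^sub>R v)"

text \<open>The derivative of \<open>f\<close> along the left-invariant vector field, whose value at \<open>g\<close> is the image of
  \<open>v\<close> under the differential of left translation by \<open>g\<close>.\<close>

definition left_inv_field ::
  "('g, 'm) monoid_scheme \<Rightarrow> ('g, 'e::real_vector) chart \<Rightarrow> 'e \<Rightarrow>
   ('g \<Rightarrow> 'b::real_normed_vector) \<Rightarrow> 'g \<Rightarrow> 'b" where
  "left_inv_field G c v f g = vector_derivative (\<lambda>t. f (g \<otimes>\<^bsub>G\<^esub> tangent_curve G c v t)) (at 0)"

definition Ad ::
  "('g, 'm) monoid_scheme \<Rightarrow> ('g, 'e::real_normed_vector) chart \<Rightarrow> 'g \<Rightarrow> 'e \<Rightarrow> 'e" where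
  "Ad G c g v =
     vector_derivative (\<lambda>t. snd c (g \<otimes>\<^bsub>G\<^esub> tangent_curve G c v t \<otimes>\<^bsub>G\<^esub> inv\<^bsub>G\<^esub> g)) (at 0)"

definition Ad_invariant_inner ::
  "('g, 'm) monoid_scheme \<Rightarrow> ('g, 'e::real_normed_vector) chart \<Rightarrow> ('e \<Rightarrow> 'e \<Rightarrow> real) \<Rightarrow> bool" where
  "Ad_invariant_inner G c \<kappa> \<longleftrightarrow> bilinear \<kappa> \<and> (\<forall>v w. \<kappa> v w = \<kappa> w v) \<and> (\<forall>v. v \<noteq> 0 \<longrightarrow> \<kappa> v v > 0) \<and>
     (\<forall>g\<in>carrier G. \<forall>v w. \<kappa> (Ad G c g v) (Ad G c g w) = \<kappa> v w)"

definition orthonormal_basis :: "('e::real_vector \<Rightarrow> 'e \<Rightarrow> real) \<Rightarrow> 'e set \<Rightarrow> bool" where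
  "orthonormal_basis \<kappa> B \<longleftrightarrow> finite B \<and> span B = UNIV \<and>
     (\<forall>v\<in>B. \<forall>w\<in>B. \<kappa> v w = (if v = w then 1 else 0))"

definition laplacian ::
  "('g, 'm) monoid_scheme \<Rightarrow> ('g, 'e::real_vector) chart \<Rightarrow> 'e set \<Rightarrow>
   ('g \<Rightarrow> 'b::real_normed_vector) \<Rightarrow> 'g \<Rightarrow> 'b" where
  "laplacian G c B f g = (\<Sum>\<xi>\<in>B. left_inv_field G c \<xi> (left_inv_field G c \<xi> f) g)"


section \<open>Representations\<close>

text \<open>The representation space is \<open>complex ^ 'n\<close>, hence automatically non-zero.\<close>

definition lie_group_rep ::
  "('g::topological_space, 'm) monoid_scheme \<Rightarrow> ('g, 'e::real_normed_vector) chart set \<Rightarrow>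
   ('g \<Rightarrow> complex ^ 'n ^ 'n) \<Rightarrow> bool" where
  "lie_group_rep G A \<rho> \<longleftrightarrow> \<rho> \<one>\<^bsub>G\<^esub> = mat 1 \<and>
     (\<forall>x\<in>carrier G. \<forall>y\<in>carrier G. \<rho> (x \<otimes>\<^bsub>G\<^esub> y) = \<rho> x ** \<rho> y) \<and>
     smooth_map A vector_space_atlas \<rho>"

definition irreducible_rep ::
  "('g, 'm) monoid_scheme \<Rightarrow> ('g \<Rightarrow> complex ^ 'n ^ 'n) \<Rightarrow> bool" where
  "irreducible_rep G \<rho> \<longleftrightarrow>
     (\<forall>U. vec.subspace U \<and> (\<forall>g\<in>carrier G. \<forall>u\<in>U. \<rho> g *v u \<in> U) \<longrightarrow> U = {0} \<or> U = UNIV)"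

definition induced_rep ::
  "('g, 'm) monoid_scheme \<Rightarrow> ('g, 'e::real_vector) chart \<Rightarrow>
   ('g \<Rightarrow> complex ^ 'n ^ 'n) \<Rightarrow> 'e \<Rightarrow> complex ^ 'n ^ 'n" where
  "induced_rep G c \<rho> v = vector_derivative (\<lambda>t. \<rho> (tangent_curve G c v t)) (at 0)"

definition casimir_rep ::
  "('g, 'm) monoid_scheme \<Rightarrow> ('g, 'e::real_vector) chart \<Rightarrow> 'e set \<Rightarrow>
   ('g \<Rightarrow> complex ^ 'n ^ 'n) \<Rightarrow> complex ^ 'n ^ 'n" where
  "casimir_rep G c B \<rho> = (\<Sum>\<xi>\<in>B. induced_rep G c \<rho> \<xi> ** induced_rep G c \<rho> \<xi>)"


section \<open>Wilson loops, merging and twisting\<close>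

text \<open>Positions in a loop are list indices, so they are counted from \<open>0\<close>.\<close>

type_synonym 'g loop = "('g \<times> int) list"

definition loops :: "('g, 'm) monoid_scheme \<Rightarrow> 'g loop set" where
  "loops G = lists (carrier G \<times> {1, -1})"

definition loop_word :: "('g, 'm) monoid_scheme \<Rightarrow> 'g loop \<Rightarrow> 'g \<Rightarrow> 'g" where
  "loop_word G l g = foldr (\<lambda>(c, \<sigma>) w. c \<otimes>\<^bsub>G\<^esub> g [^]\<^bsub>G\<^esub> \<sigma> \<otimes>\<^bsub>G\<^esub> w) l \<one>\<^bsub>G\<^esub>"

definition wilson_loop ::
  "('g, 'm) monoid_scheme \<Rightarrow> ('g \<Rightarrow> complex ^ 'n ^ 'n) \<Rightarrow> 'g loop \<Rightarrow> 'g \<Rightarrow> complex" where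
  "wilson_loop G \<rho> l g = trace (\<rho> (loop_word G l g))"

text \<open>The number of factors \<open>g\<close> or \<open>inv g\<close> lying cyclically strictly between the positions \<open>a\<close> and
  \<open>b\<close> is \<open>(b - a - 1) mod n\<close>, which is \<open>n - 1\<close> for \<open>a = b\<close>; adding \<open>n\<close> avoids truncated subtraction.
  Rotating the list by \<open>Suc a\<close> places moves the position after \<open>a\<close> to the front.\<close>

definition loop_segment ::
  "('g, 'm) monoid_scheme \<Rightarrow> ('g \<Rightarrow> complex ^ 'n ^ 'n) \<Rightarrow> 'g loop \<Rightarrow> nat \<Rightarrow> nat \<Rightarrow> 'g \<Rightarrow>
   complex ^ 'n ^ 'n" where
  "loop_segment G \<rho> l a b g =
     \<rho> (loop_word G (take ((b + length l - a - 1) mod length l) (rotate (Suc a) l)) g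
        \<otimes>\<^bsub>G\<^esub> fst (l ! b))"

definition insertion ::
  "('g, 'm) monoid_scheme \<Rightarrow> ('g, 'e::real_vector) chart \<Rightarrow> ('g \<Rightarrow> complex ^ 'n ^ 'n) \<Rightarrow>
   'e \<Rightarrow> int \<Rightarrow> 'g \<Rightarrow> complex ^ 'n ^ 'n" where
  "insertion G c \<rho> \<xi> \<sigma> g =
     (if \<sigma> = 1 then \<rho> g ** induced_rep G c \<rho> \<xi> else - (induced_rep G c \<rho> \<xi> ** \<rho> (inv\<^bsub>G\<^esub> g)))"

definition merger_at ::
  "('g, 'm) monoid_scheme \<Rightarrow> ('g, 'e::real_vector) chart \<Rightarrow> 'e set \<Rightarrow> ('g \<Rightarrow> complex ^ 'n ^ 'n) \<Rightarrow>
   'g loop \<Rightarrow> 'g loop \<Rightarrow> nat \<Rightarrow> nat \<Rightarrow> 'g \<Rightarrow> complex" where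
  "merger_at G c B \<rho> l l' j j' g =
     (\<Sum>\<xi>\<in>B. trace (loop_segment G \<rho> l j j g ** insertion G c \<rho> \<xi> (snd (l ! j)) g) *
            trace (loop_segment G \<rho> l' j' j' g ** insertion G c \<rho> \<xi> (snd (l' ! j')) g))"

definition total_merger ::
  "('g, 'm) monoid_scheme \<Rightarrow> ('g, 'e::real_vector) chart \<Rightarrow> 'e set \<Rightarrow> ('g \<Rightarrow> complex ^ 'n ^ 'n) \<Rightarrow>
   'g loop \<Rightarrow> 'g loop \<Rightarrow> 'g \<Rightarrow> complex" where
  "total_merger G c B \<rho> l l' g =
     (\<Sum>j<length l. \<Sum>j'<length l'. merger_at G c B \<rho> l l' j j' g)"

definition twisting_at ::
  "('g, 'm) monoid_scheme \<Rightarrow> ('g, 'e::real_vector) chart \<Rightarrow> 'e set \<Rightarrow> ('g \<Rightarrow> complex ^ 'n ^ 'n) \<Rightarrow>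
   'g loop \<Rightarrow> nat \<Rightarrow> nat \<Rightarrow> 'g \<Rightarrow> complex" where
  "twisting_at G c B \<rho> l j j' g =
     (\<Sum>\<xi>\<in>B. trace (loop_segment G \<rho> l j' j g ** insertion G c \<rho> \<xi> (snd (l ! j)) g **
                   loop_segment G \<rho> l j j' g ** insertion G c \<rho> \<xi> (snd (l ! j')) g))"

definition total_twisting ::
  "('g, 'm) monoid_scheme \<Rightarrow> ('g, 'e::real_vector) chart \<Rightarrow> 'e set \<Rightarrow> ('g \<Rightarrow> complex ^ 'n ^ 'n) \<Rightarrow>
   'g loop \<Rightarrow> 'g \<Rightarrow> complex" where
  "total_twisting G c B \<rho> l g =
     (\<Sum>j<length l. \<Sum>j'\<in>{..<length l} - {j}. twisting_at G c B \<rho> l j j' g)"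

end

theory Submission
  imports Defs
begin

text \<open>Haar measure on a compact group is also right-invariant, so differentiating
  \<open>\<integral> f(g \<gamma>(t)) dg = \<integral> f(g) dg\<close> at \<open>t = 0\<close> gives \<open>\<integral> \<xi>f dg = 0\<close> for every left-invariant field \<open>\<xi>\<close>.
  Integrating by parts twice yields \<open>\<integral> (\<xi>\<xi>F) \<nu> dg = \<integral> F (\<xi>\<xi>\<nu>) dg\<close> for \<open>F\<close> the product of the Wilson loops.
  In \<open>\<Sum>\<^sub>\<xi> \<xi>\<xi>F\<close> the two derivatives either hit different loops (mergers, each unordered pair twice),
  different positions of one loop (twistings), or the same position, where they insert the Casimir
  element and contribute \<open>\<lambda> F\<close> for every position.\<close>

section \<open>Differentiation along a flow\<close>

text \<open>The curve \<open>tangent_curve\<close> is a straight line in one chart, in general not a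
  one-parameter subgroup. The maps \<open>flow t\<close> therefore obey no group law, and the
  derivative of \<open>f (flow t g)\<close> at a time other than 0 need not be the field derivative
  at the moved point, so difference quotients cannot be bounded by a supremum of the field
  derivative. \<open>flow_C1\<close> instead carries a Lipschitz bound at time 0, uniform in
  \<open>g\<close>, as dominating constant under the integral. On a compact space this predicate is
  closed under sums and bilinear operations; Wilson loops and their derivatives are then explicit
  expressions in \<rho>, and differentiation in charts is confined to \<rho>, the density and its
  field derivative. Two further obstacles: \<open>normalized_haar\<close> states invariance under
  left translations, while left-invariant fields generate right translations; and the model space
  comes with a finite spanning set instead of a fixed basis, so coordinates are obtained from an
  orthogonal set.\<close>

lemma has_vector_derivative_at_0_iff:
  "(f has_vector_derivative f') (at 0) \<longleftrightarrow> ((\<lambda>h. (f h - f 0) /\<^sub>R h) \<longlongrightarrow> f') (at 0)"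
proof -
  have *: "norm (f (0 + h) - f 0 - h *\<^sub>R f') / norm h = norm ((f h - f 0) /\<^sub>R h - f')"
    if h: "h \<noteq> 0" for h
  proof -
    have "(f h - f 0) /\<^sub>R h - f' = (1 / h) *\<^sub>R (f h - f 0 - h *\<^sub>R f')"
      using h by (simp add: scaleR_diff_right inverse_eq_divide)
    then show ?thesis by simp
  qed
  have "(f has_vector_derivative f') (at 0) \<longleftrightarrow>
      ((\<lambda>h. norm (f (0 + h) - f 0 - h *\<^sub>R f') / norm h) \<longlongrightarrow> 0) (at 0)"
    by (simp only: has_vector_derivative_def has_derivative_at bounded_linear_scaleR_left simp_thms)
  also have "\<dots> \<longleftrightarrow> ((\<lambda>h. norm ((f h - f 0) /\<^sub>R h - f')) \<longlongrightarrow> 0) (at 0)"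
    by (rule Lim_cong_within) (use * in auto)
  also have "\<dots> \<longleftrightarrow> ((\<lambda>h. (f h - f 0) /\<^sub>R h) \<longlongrightarrow> f') (at 0)"
    by (simp only: tendsto_norm_zero_iff LIM_zero_iff)
  finally show ?thesis .
qed

text \<open>Differentiability is demanded at time 0 only. The last clause bounds all difference
  quotients near 0 by one constant, independent of \<open>g\<close>; \<open>K\<close> is nonnegative
  so that bounds can be multiplied.\<close>

definition flow_C1 ::
  "(real \<Rightarrow> 'g \<Rightarrow> 'g) \<Rightarrow> ('g::topological_space \<Rightarrow> 'b::real_normed_vector) \<Rightarrow> ('g \<Rightarrow> 'b) \<Rightarrow> bool" where
  "flow_C1 \<Phi> f f' \<longleftrightarrow> continuous_on UNIV f \<and> continuous_on UNIV f' \<and>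
     (\<forall>g. \<Phi> 0 g = g \<and> ((\<lambda>t. f (\<Phi> t g)) has_vector_derivative f' g) (at 0)) \<and>
     (\<exists>K\<ge>0. \<forall>\<^sub>F t in at 0. \<forall>g. norm (f (\<Phi> t g) - f g) \<le> K * \<bar>t\<bar>)"

lemma flow_C1_continuous:
  assumes "flow_C1 \<Phi> f f'"
  shows "continuous_on UNIV f" and "continuous_on UNIV f'"
  using assms by (auto simp: flow_C1_def)

lemma flow_C1_const:
  assumes "\<And>g. \<Phi> 0 g = g"
  shows "flow_C1 \<Phi> (\<lambda>g. a) (\<lambda>g. 0)"
  unfolding flow_C1_def using assms by (auto intro!: continuous_intros exI[of _ 0])

lemma flow_C1_bounded_linear:
  assumes f: "flow_C1 \<Phi> f f'" and h: "bounded_linear h"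
  shows "flow_C1 \<Phi> (\<lambda>g. h (f g)) (\<lambda>g. h (f' g))"
proof -
  interpret h: bounded_linear h by fact
  obtain C where C: "C > 0" "\<And>x. norm (h x) \<le> norm x * C" using h.pos_bounded by blast
  obtain K where K: "K \<ge> 0" "\<forall>\<^sub>F t in at 0. \<forall>g. norm (f (\<Phi> t g) - f g) \<le> K * \<bar>t\<bar>"
    using f by (auto simp: flow_C1_def)
  have "\<forall>\<^sub>F t in at 0. \<forall>g. norm (h (f (\<Phi> t g)) - h (f g)) \<le> (K * C) * \<bar>t\<bar>"
    using K(2)
  proof eventually_elim
    case (elim t)
    show ?case
    proof
      fix g
      have "norm (h (f (\<Phi> t g)) - h (f g)) \<le> norm (f (\<Phi> t g) - f g) * C"
        unfolding h.diff[symmetric] by (rule C(2))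
      also have "\<dots> \<le> (K * \<bar>t\<bar>) * C"
        using elim C(1) by (intro mult_right_mono) auto
      finally show "norm (h (f (\<Phi> t g)) - h (f g)) \<le> (K * C) * \<bar>t\<bar>"
        by (simp add: mult_ac)
    qed
  qed
  moreover have "K * C \<ge> 0" using K C by simp
  ultimately show ?thesis
    using f unfolding flow_C1_def
    by (auto intro!: h.has_vector_derivative h.continuous_on)
qed

lemma flow_C1_add:
  assumes f: "flow_C1 \<Phi> f f'" and h: "flow_C1 \<Phi> h h'"
  shows "flow_C1 \<Phi> (\<lambda>g. f g + h g) (\<lambda>g. f' g + h' g)"
proof -
  obtain K where K: "K \<ge> 0" "\<forall>\<^sub>F t in at 0. \<forall>g. norm (f (\<Phi> t g) - f g) \<le> K * \<bar>t\<bar>"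
    using f by (auto simp: flow_C1_def)
  obtain L where L: "L \<ge> 0" "\<forall>\<^sub>F t in at 0. \<forall>g. norm (h (\<Phi> t g) - h g) \<le> L * \<bar>t\<bar>"
    using h by (auto simp: flow_C1_def)
  have "\<forall>\<^sub>F t in at 0. \<forall>g. norm (f (\<Phi> t g) + h (\<Phi> t g) - (f g + h g)) \<le> (K + L) * \<bar>t\<bar>"
    using K(2) L(2)
  proof eventually_elim
    case (elim t)
    show ?case
    proof
      fix g
      have "norm (f (\<Phi> t g) + h (\<Phi> t g) - (f g + h g)) \<le> norm (f (\<Phi> t g) - f g) + norm (h (\<Phi> t g) - h g)"
        by (rule norm_diff_triangle_ineq)
      also have "\<dots> \<le> (K + L) * \<bar>t\<bar>"
        using elim[THEN spec, of g] by (auto simp: algebra_simps)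
      finally show "norm (f (\<Phi> t g) + h (\<Phi> t g) - (f g + h g)) \<le> (K + L) * \<bar>t\<bar>" .
    qed
  qed
  moreover have "K + L \<ge> 0" using K L by simp
  ultimately show ?thesis
    using f h unfolding flow_C1_def
    by (auto intro!: has_vector_derivative_add continuous_intros)
qed

lemma flow_C1_sum:
  assumes "\<And>g. \<Phi> 0 g = g" "\<And>i. i \<in> I \<Longrightarrow> flow_C1 \<Phi> (f i) (f' i)"
  shows "flow_C1 \<Phi> (\<lambda>g. \<Sum>i\<in>I. f i g) (\<lambda>g. \<Sum>i\<in>I. f' i g)"
  using assms(2)
proof (induction I rule: infinite_finite_induct)
  case (insert x F)
  then show ?case by (auto intro!: flow_C1_add)
qed (auto intro!: flow_C1_const assms(1))

text \<open>The uniform Lipschitz bound survives because continuous functions on a compact space are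
  bounded: one factor is replaced by its supremum while the other is differenced.\<close>

lemma flow_C1_bilinear:
  assumes "compact (UNIV :: 'g::topological_space set)"
    and f: "flow_C1 \<Phi> f f'" and h: "flow_C1 \<Phi> h (h' :: 'g \<Rightarrow> _)" and m: "bounded_bilinear m"
  shows "flow_C1 \<Phi> (\<lambda>g. m (f g) (h g)) (\<lambda>g. m (f' g) (h g) + m (f g) (h' g))"
proof -
  interpret m: bounded_bilinear m by fact
  obtain C where C: "C > 0" "\<And>x y. norm (m x y) \<le> norm x * norm y * C"
    using m.pos_bounded by blast
  have bound: "\<exists>b\<ge>0. \<forall>x. norm (u x) \<le> b" if "continuous_on UNIV u"
    for u :: "'g \<Rightarrow> 'x::real_normed_vector"
  proof -
    have "bounded (u ` UNIV)"
      using compact_continuous_image[OF that assms(1)] compact_imp_bounded by blast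
    then obtain b where b: "\<And>x. norm (u x) \<le> b" by (auto simp: bounded_iff)
    have "b \<ge> 0" using norm_ge_zero b by (rule order_trans)
    with b show ?thesis by auto
  qed
  obtain F where F: "F \<ge> 0" "\<And>x. norm (f x) \<le> F"
    using bound[of f] f by (auto simp: flow_C1_def)
  obtain H where H: "H \<ge> 0" "\<And>x. norm (h x) \<le> H"
    using bound[of h] h by (auto simp: flow_C1_def)
  obtain K where K: "K \<ge> 0" "\<forall>\<^sub>F t in at 0. \<forall>g. norm (f (\<Phi> t g) - f g) \<le> K * \<bar>t\<bar>"
    using f by (auto simp: flow_C1_def)
  obtain L where L: "L \<ge> 0" "\<forall>\<^sub>F t in at 0. \<forall>g. norm (h (\<Phi> t g) - h g) \<le> L * \<bar>t\<bar>"
    using h by (auto simp: flow_C1_def)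
  have "\<forall>\<^sub>F t in at 0. \<forall>g. norm (m (f (\<Phi> t g)) (h (\<Phi> t g)) - m (f g) (h g)) \<le> (K * H * C + F * L * C) * \<bar>t\<bar>"
    using K(2) L(2)
  proof eventually_elim
    case (elim t)
    show ?case
    proof
      fix g
      have "m (f (\<Phi> t g)) (h (\<Phi> t g)) - m (f g) (h g) =
          m (f (\<Phi> t g) - f g) (h (\<Phi> t g)) + m (f g) (h (\<Phi> t g) - h g)"
        by (simp add: m.diff_left m.diff_right)
      also have "norm \<dots> \<le> norm (f (\<Phi> t g) - f g) * norm (h (\<Phi> t g)) * C + norm (f g) * norm (h (\<Phi> t g) - h g) * C"
        by (intro norm_triangle_mono C)
      also have "\<dots> \<le> (K * \<bar>t\<bar>) * H * C + F * (L * \<bar>t\<bar>) * C"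
        using elim[THEN spec, of g] C(1) F H K L
        by (intro add_mono mult_right_mono mult_mono) auto
      finally show "norm (m (f (\<Phi> t g)) (h (\<Phi> t g)) - m (f g) (h g)) \<le> (K * H * C + F * L * C) * \<bar>t\<bar>"
        by (simp add: algebra_simps)
    qed
  qed
  moreover have "K * H * C + F * L * C \<ge> 0" using K L C F H by simp
  moreover have "((\<lambda>t. m (f (\<Phi> t g)) (h (\<Phi> t g))) has_vector_derivative m (f' g) (h g) + m (f g) (h' g)) (at 0)" for g
  proof -
    have *: "\<Phi> 0 g = g" "((\<lambda>t. f (\<Phi> t g)) has_vector_derivative f' g) (at 0)"
      "((\<lambda>t. h (\<Phi> t g)) has_vector_derivative h' g) (at 0)"
      using f h by (auto simp: flow_C1_def)
    show ?thesis
      using m.has_vector_derivative[OF *(2,3)] *(1) by (simp add: add.commute)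
  qed
  ultimately show ?thesis
    using f h unfolding flow_C1_def
    by (auto intro!: m.continuous_on continuous_intros)
qed

lemma flow_C1_mult:
  fixes f h :: "'g::topological_space \<Rightarrow> 'a::real_normed_algebra"
  assumes "compact (UNIV :: 'g set)" "flow_C1 \<Phi> f f'" "flow_C1 \<Phi> h h'"
  shows "flow_C1 \<Phi> (\<lambda>g. f g * h g) (\<lambda>g. f' g * h g + f g * h' g)"
  using assms by (rule flow_C1_bilinear[OF _ _ _ bounded_bilinear_mult])

text \<open>The differentiated factor is omitted from the product rather than divided out, since
  Wilson loops may vanish.\<close>

lemma flow_C1_prod:
  fixes f :: "'i \<Rightarrow> 'g::topological_space \<Rightarrow> 'a::{real_normed_algebra,comm_ring_1}"
  assumes cpt: "compact (UNIV :: 'g set)" and "\<And>g. \<Phi> 0 g = g" and "finite I"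
    and "\<And>i. i \<in> I \<Longrightarrow> flow_C1 \<Phi> (f i) (f' i)"
  shows "flow_C1 \<Phi> (\<lambda>g. \<Prod>i\<in>I. f i g) (\<lambda>g. \<Sum>i\<in>I. f' i g * (\<Prod>k\<in>I - {i}. f k g))"
  using assms(3,4)
proof (induction I rule: finite_induct)
  case empty
  then show ?case by (auto intro: flow_C1_const assms(2))
next
  case (insert x F)
  have *: "(\<Sum>i\<in>F. f' i g * (\<Prod>k\<in>insert x F - {i}. f k g)) =
      f x g * (\<Sum>i\<in>F. f' i g * (\<Prod>k\<in>F - {i}. f k g))" for g
    unfolding sum_distrib_left
  proof (rule sum.cong)
    fix i assume i: "i \<in> F"
    then have "insert x F - {i} = insert x (F - {i})" using insert by auto
    then show "f' i g * (\<Prod>k\<in>insert x F - {i}. f k g) = f x g * (f' i g * (\<Prod>k\<in>F - {i}. f k g))"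
      using insert by simp
  qed simp
  have "flow_C1 \<Phi> (\<lambda>g. f x g * (\<Prod>i\<in>F. f i g))
      (\<lambda>g. f' x g * (\<Prod>i\<in>F. f i g) + f x g * (\<Sum>i\<in>F. f' i g * (\<Prod>k\<in>F - {i}. f k g)))"
    using insert by (intro flow_C1_mult cpt) auto
  moreover have "insert x F - {x} = F" using insert by auto
  ultimately show ?case using insert(1,2) by (simp add: *)
qed

section \<open>Differentiation under the integral on a compact space\<close>

lemma integrable_continuous_compact:
  fixes f :: "'g::topological_space \<Rightarrow> 'b::{banach, second_countable_topology}"
  assumes "compact (UNIV :: 'g set)" "finite_measure M" "sets M = sets borel" "continuous_on UNIV f"
  shows "integrable M f"
proof -
  interpret finite_measure M by fact
  have "bounded (f ` UNIV)"
    using compact_continuous_image[OF assms(4,1)] compact_imp_bounded by blast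
  then obtain b where b: "\<And>x. norm (f x) \<le> b" by (auto simp: bounded_iff)
  have [measurable]: "f \<in> borel_measurable M"
    using borel_measurable_continuous_onI[OF assms(4)] measurable_cong_sets[OF assms(3) refl] by blast
  show ?thesis
    using b by (intro integrable_const_bound[of _ b]) auto
qed

text \<open>By invariance every difference quotient has integral 0, and the quotients converge
  pointwise to \<open>f'\<close>. The Lipschitz constant dominates them and is integrable because
  the measure is finite.\<close>

lemma integral_flow_derivative:
  fixes f :: "'g::topological_space \<Rightarrow> 'b::{banach, second_countable_topology}"
  assumes cpt: "compact (UNIV :: 'g set)" and M: "finite_measure M" "sets M = sets borel"
    and cont: "\<And>t. continuous_on UNIV (\<Phi> t)"
    and inv: "\<And>t. (\<integral>g. f (\<Phi> t g) \<partial>M) = (\<integral>g. f g \<partial>M)"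
    and f: "flow_C1 \<Phi> f f'"
  shows "(\<integral>g. f' g \<partial>M) = 0"
proof -
  interpret finite_measure M by fact
  have cf: "continuous_on UNIV f" and cf': "continuous_on UNIV f'"
    using f by (auto simp: flow_C1_def)
  obtain K where K: "K \<ge> 0" "\<forall>\<^sub>F t in at 0. \<forall>g. norm (f (\<Phi> t g) - f g) \<le> K * \<bar>t\<bar>"
    using f by (auto simp: flow_C1_def)
  then obtain d where d: "d > 0"
    "\<And>t g. t \<noteq> 0 \<Longrightarrow> \<bar>t\<bar> < d \<Longrightarrow> norm (f (\<Phi> t g) - f g) \<le> K * \<bar>t\<bar>"
    by (auto simp: eventually_at dist_norm)
  \<comment> \<open>Dominated convergence runs along a sequence; the offset 2 keeps every term, also
    the one for \<open>n = 0\<close>, strictly below \<open>d\<close>.\<close>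
  define t where "t = (\<lambda>n. d / (2 + real n))"
  have t: "t n > 0" "\<bar>t n\<bar> < d" "t n \<noteq> 0" for n
    using d(1) by (auto simp: t_def field_simps add_pos_nonneg intro!: add_pos_nonneg)
  have t0: "t \<longlonglongrightarrow> 0"
    unfolding t_def by real_asymp
  have tat: "filterlim t (at 0) sequentially"
    using t0 t by (auto simp: filterlim_at)
  define s where "s = (\<lambda>n g. (f (\<Phi> (t n) g) - f g) /\<^sub>R t n)"
  have cs: "continuous_on UNIV (s n)" for n
    unfolding s_def
    by (intro continuous_intros cf continuous_on_compose2[OF cf cont]) auto
  note int = integrable_continuous_compact[OF cpt M]
  have lim: "(\<lambda>n. s n g) \<longlonglongrightarrow> f' g" for g
  proof -
    have *: "\<Phi> 0 g = g" "((\<lambda>t. f (\<Phi> t g)) has_vector_derivative f' g) (at 0)"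
      using f by (auto simp: flow_C1_def)
    have "((\<lambda>h. (f (\<Phi> h g) - f g) /\<^sub>R h) \<longlongrightarrow> f' g) (at 0)"
      using *(2) *(1) by (simp add: has_vector_derivative_at_0_iff)
    from filterlim_compose[OF this tat] show ?thesis by (simp add: s_def)
  qed
  have "(\<lambda>n. \<integral>g. s n g \<partial>M) \<longlonglongrightarrow> (\<integral>g. f' g \<partial>M)"
  proof (rule integral_dominated_convergence[where w="\<lambda>_. K"])
    show "AE g in M. norm (s n g) \<le> K" for n
    proof (rule AE_I2)
      fix g
      have "norm (s n g) = norm (f (\<Phi> (t n) g) - f g) / t n"
        using t(1)[of n] unfolding s_def norm_scaleR by (simp add: inverse_eq_divide)
      then show "norm (s n g) \<le> K"
        using d(2)[OF t(3,2), of n g] t(1)[of n] by (simp add: divide_le_eq)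
    qed
  qed (use lim int[OF cs] int[OF cf'] in auto)
  moreover have "(\<integral>g. s n g \<partial>M) = 0" for n
  proof -
    have "integrable M (\<lambda>g. f (\<Phi> (t n) g))"
      by (intro int continuous_on_compose2[OF cf cont]) auto
    then show ?thesis using int[OF cf] inv[of "t n"] by (simp add: s_def)
  qed
  ultimately show ?thesis using LIMSEQ_unique[of "\<lambda>n. 0::'b"] by auto
qed

section \<open>Functions of class C^k\<close>

lemma Ck_on_Suc_imp: "Ck_on (Suc k) S f \<Longrightarrow> Ck_on k S f"
proof (induction k arbitrary: f)
  case 0
  then obtain f' where "\<forall>x\<in>S. (f has_derivative f' x) (at x)" by auto
  then show ?case
    unfolding Ck_on.simps by (meson continuous_at_imp_continuous_on has_derivative_continuous)
next
  case (Suc k)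
  from Suc.prems obtain f' where "\<forall>x\<in>S. (f has_derivative f' x) (at x)"
    "\<forall>v. Ck_on (Suc k) S (\<lambda>x. f' x v)" by (subst (asm) Ck_on.simps(2)) blast
  then show ?case using Suc.IH by auto
qed

lemma Ck_on_imp_continuous_on: "Ck_on k S f \<Longrightarrow> continuous_on S f"
  by (induction k) (use Ck_on_Suc_imp in auto)

lemma Ck_on_cong:
  assumes "open S" "\<And>x. x \<in> S \<Longrightarrow> f x = g x" "Ck_on k S f"
  shows "Ck_on k S g"
proof (cases k)
  case 0
  then show ?thesis using assms continuous_on_cong[of S S f g] by simp
next
  case (Suc m)
  then obtain f' where "\<forall>x\<in>S. (f has_derivative f' x) (at x)" "\<forall>v. Ck_on m S (\<lambda>x. f' x v)"
    using assms(3) by auto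
  moreover from this have "\<forall>x\<in>S. (g has_derivative f' x) (at x)"
    using has_derivative_transform_within_open[OF _ assms(1)] assms(2) by metis
  ultimately show ?thesis using Suc by auto
qed

lemma Ck_on_const: "Ck_on k S (\<lambda>x. a)"
  by (induction k arbitrary: a) (auto intro!: exI[of _ "\<lambda>_ _. 0"])

lemma Ck_on_bounded_linear:
  assumes "bounded_linear h"
  shows "Ck_on k S f \<Longrightarrow> Ck_on k S (\<lambda>x. h (f x))"
proof (induction k arbitrary: f)
  case 0
  then show ?case using bounded_linear.continuous_on[OF assms] by simp
next
  case (Suc k)
  then obtain f' where f': "\<forall>x\<in>S. (f has_derivative f' x) (at x)" "\<forall>v. Ck_on k S (\<lambda>x. f' x v)"
    by auto
  then show ?case using Suc.IH
    by (auto intro!: exI[of _ "\<lambda>x v. h (f' x v)"] bounded_linear.has_derivative[OF assms])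
qed

lemma Ck_on_add:
  "Ck_on k S f \<Longrightarrow> Ck_on k S g \<Longrightarrow> Ck_on k S (\<lambda>x. f x + g x)"
proof (induction k arbitrary: f g)
  case 0
  then show ?case by (auto intro: continuous_intros)
next
  case (Suc k)
  from Suc.prems obtain f' g' where "\<forall>x\<in>S. (f has_derivative f' x) (at x)" "\<forall>v. Ck_on k S (\<lambda>x. f' x v)"
    "\<forall>x\<in>S. (g has_derivative g' x) (at x)" "\<forall>v. Ck_on k S (\<lambda>x. g' x v)"
    by auto
  then show ?case using Suc.IH
    by (auto intro!: exI[of _ "\<lambda>x v. f' x v + g' x v"] has_derivative_add)
qed

lemma Ck_on_sum:
  "(\<And>i. i \<in> I \<Longrightarrow> Ck_on k S (f i)) \<Longrightarrow> Ck_on k S (\<lambda>x. \<Sum>i\<in>I. f i x)"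
  by (induction I rule: infinite_finite_induct) (auto intro: Ck_on_const Ck_on_add)

lemma Ck_on_scaleR:
  "Ck_on k S f \<Longrightarrow> Ck_on k S g \<Longrightarrow> Ck_on k S (\<lambda>x. f x *\<^sub>R g x)"
proof (induction k arbitrary: f g)
  case 0
  then show ?case by (auto intro: continuous_intros)
next
  case (Suc k)
  from Suc.prems obtain f' g' where fg: "\<forall>x\<in>S. (f has_derivative f' x) (at x)" "\<forall>v. Ck_on k S (\<lambda>x. f' x v)"
    "\<forall>x\<in>S. (g has_derivative g' x) (at x)" "\<forall>v. Ck_on k S (\<lambda>x. g' x v)"
    by auto
  have fg0: "Ck_on k S f" "Ck_on k S g"
    using Suc.prems[THEN Ck_on_Suc_imp] by auto
  have "Ck_on k S (\<lambda>x. f x *\<^sub>R g' x v + f' x v *\<^sub>R g x)" for v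
    using fg fg0 by (intro Ck_on_add Suc.IH) auto
  moreover have "((\<lambda>x. f x *\<^sub>R g x) has_derivative (\<lambda>v. f x *\<^sub>R g' x v + f' x v *\<^sub>R g x)) (at x)"
    if "x \<in> S" for x
    using fg that by (intro has_derivative_scaleR) auto
  ultimately show ?case
    unfolding Ck_on.simps by (intro exI[of _ "\<lambda>x v. f x *\<^sub>R g' x v + f' x v *\<^sub>R g x"]) blast
qed

text \<open>The derivative of a slice in direction \<open>v\<close> is that of \<open>f\<close> in
  direction \<open>(v, 0)\<close>, so the induction applies to directional derivatives. It serves to
  evaluate the differential of the multiplication with the second slot at the identity.\<close>

lemma Ck_on_slice:
  assumes "\<And>x. x \<in> T \<Longrightarrow> (x, y) \<in> S"
  shows "Ck_on k S f \<Longrightarrow> Ck_on k T (\<lambda>x. f (x, y))"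
proof (induction k arbitrary: f)
  case 0
  then show ?case
    using assms by (auto intro!: continuous_on_compose2[of S f] continuous_intros)
next
  case (Suc k)
  then obtain f' where f': "\<forall>x\<in>S. (f has_derivative f' x) (at x)" "\<forall>v. Ck_on k S (\<lambda>x. f' x v)"
    by auto
  have "((\<lambda>x. f (x, y)) has_derivative (\<lambda>v. f' (x, y) (v, 0))) (at x)" if "x \<in> T" for x
    using assms[OF that] f'(1)
    by (intro has_derivative_compose[where f="\<lambda>x. (x, y)" and g=f]) (auto intro!: derivative_eq_intros)
  then show ?case using Suc.IH[of "\<lambda>x. f' x (_, 0)"] f'(2)
    by (auto intro!: exI[of _ "\<lambda>x v. f' (x, y) (v, 0)"])
qed

text \<open>Stands in for coordinates: with an orthogonal spanning set the coefficients are explicit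
  bounded linear functions of \<open>v\<close>.\<close>

lemma finite_span_orthogonal_expansion:
  assumes "\<exists>B::'a::real_inner set. finite B \<and> span B = UNIV"
  shows "\<exists>C. finite C \<and> (\<forall>v::'a. v = (\<Sum>b\<in>C. (v \<bullet> b / (b \<bullet> b)) *\<^sub>R b))"
proof -
  obtain C :: "'a set" where C: "finite C" "span C = UNIV" "pairwise orthogonal C"
    using assms basis_orthogonal by metis
  have "v = (\<Sum>b\<in>C. (v \<bullet> b / (b \<bullet> b)) *\<^sub>R b)" for v :: 'a
  proof -
    obtain u where u: "v = (\<Sum>b\<in>C. u b *\<^sub>R b)"
      using span_finite[OF C(1)] C(2) by auto
    \<comment> \<open>The orthogonal set may contain 0; for that vector both sides vanish whatever
      the coefficient.\<close>
    have "(v \<bullet> b / (b \<bullet> b)) *\<^sub>R b = u b *\<^sub>R b" if "b \<in> C" for b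
    proof -
      have "v \<bullet> b = (\<Sum>b'\<in>C. u b' * (b' \<bullet> b))" by (simp add: u inner_sum_left)
      also have "\<dots> = (\<Sum>b'\<in>C. if b' = b then u b * (b \<bullet> b) else 0)"
        using C(3) that by (intro sum.cong) (auto simp: pairwise_def orthogonal_def)
      also have "\<dots> = u b * (b \<bullet> b)" using C(1) that by simp
      finally show ?thesis by (cases "b = 0") auto
    qed
    then show ?thesis using u by (metis (no_types, lifting) sum.cong)
  qed
  with C(1) show ?thesis by blast
qed

text \<open>Regularity of the derivative is known for fixed directions, whereas here the direction
  moves with the point. Expanding \<open>w x\<close> gives a finite sum of regular coefficients
  times derivatives in fixed directions.\<close>

lemma Ck_on_directional:
  fixes w :: "'a::real_inner \<Rightarrow> 'a"
  assumes fd: "\<exists>B::'a set. finite B \<and> span B = UNIV"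
    and f': "\<And>x. x \<in> S \<Longrightarrow> bounded_linear (f' x)" "\<And>v. Ck_on k S (\<lambda>x. f' x v)"
    and w: "Ck_on k S w" and S: "open S"
  shows "Ck_on k S (\<lambda>x. f' x (w x))"
proof -
  obtain C :: "'a set" where C: "finite C" "\<And>v. v = (\<Sum>b\<in>C. (v \<bullet> b / (b \<bullet> b)) *\<^sub>R b)"
    using finite_span_orthogonal_expansion[OF fd] by blast
  have *: "Ck_on k S (\<lambda>x. \<Sum>b\<in>C. (w x \<bullet> b / (b \<bullet> b)) *\<^sub>R f' x b)"
  proof (rule Ck_on_sum)
    fix b :: 'a
    have "bounded_linear (\<lambda>y. y \<bullet> b / (b \<bullet> b))"
      by (rule bounded_linear_compose[OF bounded_linear_divide bounded_linear_inner_left])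
    from Ck_on_bounded_linear[OF this w]
    show "Ck_on k S (\<lambda>x. (w x \<bullet> b / (b \<bullet> b)) *\<^sub>R f' x b)"
      by (rule Ck_on_scaleR[OF _ f'(2)])
  qed
  have "(\<Sum>b\<in>C. (w x \<bullet> b / (b \<bullet> b)) *\<^sub>R f' x b) = f' x (w x)" if "x \<in> S" for x
  proof -
    interpret bounded_linear "f' x" by (rule f'(1)[OF that])
    have "f' x (w x) = f' x (\<Sum>b\<in>C. (w x \<bullet> b / (b \<bullet> b)) *\<^sub>R b)"
      by (rule arg_cong[OF C(2)])
    then show ?thesis by (simp add: sum scaleR)
  qed
  then show ?thesis using * by (rule Ck_on_cong[OF S])
qed

text \<open>Finitely many directions control the operator norm of the derivative near
  \<open>x\<close>; the mean value inequality on a ball, which is convex, then gives the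
  constant.\<close>

lemma Ck_on_1_locally_lipschitz:
  fixes x :: "'a::real_inner"
  assumes fd: "\<exists>B::'a set. finite B \<and> span B = UNIV"
    and f: "Ck_on (Suc 0) S f" and S: "open S" "x \<in> S"
  obtains K \<delta> where "K \<ge> 0" "\<delta> > 0" "ball x \<delta> \<subseteq> S"
    "\<And>y z. y \<in> ball x \<delta> \<Longrightarrow> z \<in> ball x \<delta> \<Longrightarrow> norm (f y - f z) \<le> K * norm (y - z)"
proof -
  obtain C :: "'a set" where C: "finite C" "\<And>v. v = (\<Sum>b\<in>C. (v \<bullet> b / (b \<bullet> b)) *\<^sub>R b)"
    using finite_span_orthogonal_expansion[OF fd] by blast
  obtain f' where f': "\<And>x. x \<in> S \<Longrightarrow> (f has_derivative f' x) (at x)" "\<And>v. continuous_on S (\<lambda>x. f' x v)"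
    using f by auto
  have "\<forall>\<^sub>F y in nhds x. norm (f' y b) < norm (f' x b) + 1" for b
  proof -
    have "isCont (\<lambda>y. norm (f' y b)) x"
      using f'(2) S by (auto simp: continuous_on_eq_continuous_at intro: continuous_norm)
    then have "((\<lambda>y. norm (f' y b)) \<longlongrightarrow> norm (f' x b)) (nhds x)"
      by (simp add: isCont_def tendsto_at_iff_tendsto_nhds[of "\<lambda>y. norm (f' y b)"])
    then show ?thesis by (rule order_tendstoD) simp
  qed
  then have "\<forall>\<^sub>F y in nhds x. y \<in> S \<and> (\<forall>b\<in>C. norm (f' y b) < norm (f' x b) + 1)"
    using S by (intro eventually_conj eventually_nhds_in_open eventually_ball_finite C(1)) auto
  then obtain \<delta> where \<delta>: "\<delta> > 0"
    "\<And>y. y \<in> ball x \<delta> \<Longrightarrow> y \<in> S \<and> (\<forall>b\<in>C. norm (f' y b) < norm (f' x b) + 1)"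
    by (auto simp: eventually_nhds_metric dist_commute)
  \<comment> \<open>Cauchy-Schwarz bounds each coefficient by
    \<open>norm v * norm b / (b \<bullet> b)\<close>; the \<open>+ 1\<close> absorbs the variation
    of \<open>f' y b\<close> near \<open>x\<close>.\<close>
  define K where "K = (\<Sum>b\<in>C. norm b / (b \<bullet> b) * (norm (f' x b) + 1))"
  have K: "K \<ge> 0" unfolding K_def by (intro sum_nonneg) auto
  have "onorm (f' y) \<le> K" if y: "y \<in> ball x \<delta>" for y
  proof (rule onorm_bound[OF K])
    fix v
    interpret bounded_linear "f' y" using has_derivative_bounded_linear f'(1) \<delta>(2)[OF y] by blast
    have "norm (f' y v) = norm (\<Sum>b\<in>C. (v \<bullet> b / (b \<bullet> b)) *\<^sub>R f' y b)"
      using arg_cong[OF C(2), of "f' y" v] by (simp add: sum scaleR)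
    also have "\<dots> \<le> (\<Sum>b\<in>C. norm v * norm b / (b \<bullet> b) * (norm (f' x b) + 1))"
    proof (rule sum_norm_le)
      fix b assume b: "b \<in> C"
      have "norm ((v \<bullet> b / (b \<bullet> b)) *\<^sub>R f' y b) = \<bar>v \<bullet> b\<bar> / (b \<bullet> b) * norm (f' y b)"
        by (simp add: abs_of_nonneg)
      also have "\<dots> \<le> norm v * norm b / (b \<bullet> b) * (norm (f' x b) + 1)"
        using \<delta>(2)[OF y] b Cauchy_Schwarz_ineq2[of v b]
        by (intro mult_mono divide_right_mono) (auto intro: less_imp_le)
      finally show "norm ((v \<bullet> b / (b \<bullet> b)) *\<^sub>R f' y b) \<le> norm v * norm b / (b \<bullet> b) * (norm (f' x b) + 1)" .
    qed
    also have "\<dots> = K * norm v"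
      by (simp add: K_def sum_distrib_left sum_distrib_right mult_ac)
    finally show "norm (f' y v) \<le> K * norm v" .
  qed
  note on = this
  have "norm (f y - f z) \<le> K * norm (y - z)" if "y \<in> ball x \<delta>" "z \<in> ball x \<delta>" for y z
  proof (rule differentiable_bound[of "ball x \<delta>" f f' K])
    show "(f has_derivative f' u) (at u within ball x \<delta>)" if "u \<in> ball x \<delta>" for u
      using \<delta>(2)[OF that] by (blast intro: has_derivative_at_withinI[OF f'(1)])
    show "onorm (f' u) \<le> K" if "u \<in> ball x \<delta>" for u
      by (rule on[OF that])
  qed (rule convex_ball that)+
  moreover have "ball x \<delta> \<subseteq> S" using \<delta>(2) by blast
  ultimately show ?thesis by (intro that[OF K \<delta>(1)])
qed

text \<open>For increments along a single direction it is enough to bound \<open>f' y v\<close> near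
  \<open>x\<close>. The application is to the multiplication in coordinates, moved in its second
  slot.\<close>

lemma Ck_on_1_directional_lipschitz:
  fixes f :: "'a::real_normed_vector \<Rightarrow> 'b::real_normed_vector"
  assumes f: "Ck_on (Suc 0) S f" and S: "open S" "x \<in> S"
  obtains K \<delta> where "K \<ge> 0" "\<delta> > 0"
    "\<And>y t. y \<in> ball x \<delta> \<Longrightarrow> \<bar>t\<bar> < \<delta> \<Longrightarrow> norm (f (y + t *\<^sub>R v) - f y) \<le> K * \<bar>t\<bar>"
proof -
  obtain f' where f': "\<And>x. x \<in> S \<Longrightarrow> (f has_derivative f' x) (at x)" "\<And>v. continuous_on S (\<lambda>x. f' x v)"
    using f by auto
  define K where "K = norm (f' x v) + 1"
  have K: "K \<ge> 0" by (simp add: K_def)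
  have "isCont (\<lambda>y. norm (f' y v)) x"
    using f'(2) S by (auto simp: continuous_on_eq_continuous_at intro: continuous_norm)
  then have "((\<lambda>y. norm (f' y v)) \<longlongrightarrow> norm (f' x v)) (nhds x)"
    by (simp add: isCont_def tendsto_at_iff_tendsto_nhds[of "\<lambda>y. norm (f' y v)"])
  then have "\<forall>\<^sub>F y in nhds x. norm (f' y v) < K"
    by (rule order_tendstoD) (simp add: K_def)
  then have "\<forall>\<^sub>F y in nhds x. y \<in> S \<and> norm (f' y v) < K"
    using S by (intro eventually_conj eventually_nhds_in_open) auto
  then obtain \<epsilon> where \<epsilon>: "\<epsilon> > 0" "\<And>y. y \<in> ball x \<epsilon> \<Longrightarrow> y \<in> S \<and> norm (f' y v) < K"
    by (auto simp: eventually_nhds_metric dist_commute)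
  \<comment> \<open>In \<open>1 + norm v\<close> the summand 1 is the share of the base point and
    \<open>norm v\<close> that of the motion; together they stay within \<epsilon>.\<close>
  define \<delta> where "\<delta> = \<epsilon> / (1 + norm v)"
  have v1: "1 + norm v > 0" by (simp add: add_pos_nonneg)
  then have \<delta>: "\<delta> > 0" using \<epsilon>(1) by (simp add: \<delta>_def)
  have "norm (f (y + t *\<^sub>R v) - f y) \<le> K * \<bar>t\<bar>" if y: "y \<in> ball x \<delta>" and t: "\<bar>t\<bar> < \<delta>" for y t
  proof -
    have in_ball: "y + s *\<^sub>R v \<in> ball x \<epsilon>" if "\<bar>s\<bar> < \<delta>" for s
    proof -
      have "dist x (y + s *\<^sub>R v) \<le> dist x y + dist y (y + s *\<^sub>R v)" by (rule dist_triangle)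
      also have "\<dots> = dist x y + \<bar>s\<bar> * norm v" by (simp add: dist_norm)
      also have "\<dots> < \<delta> + \<delta> * norm v"
        using y that by (intro add_less_le_mono mult_right_mono) auto
      also have "\<delta> + \<delta> * norm v = \<delta> * (1 + norm v)" by (simp add: distrib_left)
      also have "\<dots> = \<epsilon>" using v1 by (simp add: \<delta>_def)
      finally show ?thesis by simp
    qed
    have "norm (f (y + t *\<^sub>R v) - f (y + 0 *\<^sub>R v)) \<le> K * norm (t - 0)"
    proof (rule differentiable_bound[of "{-\<delta><..<\<delta>}" "\<lambda>s. f (y + s *\<^sub>R v)" "\<lambda>s h. f' (y + s *\<^sub>R v) (h *\<^sub>R v)"])
      fix s assume "s \<in> {-\<delta><..<\<delta>}"
      then have s: "y + s *\<^sub>R v \<in> S" "norm (f' (y + s *\<^sub>R v) v) < K"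
        using \<epsilon>(2)[OF in_ball[of s]] by auto
      show "((\<lambda>s. f (y + s *\<^sub>R v)) has_derivative (\<lambda>h. f' (y + s *\<^sub>R v) (h *\<^sub>R v))) (at s within {-\<delta><..<\<delta>})"
        by (rule has_derivative_at_withinI)
          (rule has_derivative_compose[where f="\<lambda>s. y + s *\<^sub>R v" and g=f, OF _ f'(1)[OF s(1)]],
           auto intro!: derivative_eq_intros)
      interpret bounded_linear "f' (y + s *\<^sub>R v)" using has_derivative_bounded_linear f'(1) s(1) by blast
      show "onorm (\<lambda>h. f' (y + s *\<^sub>R v) (h *\<^sub>R v)) \<le> K"
      proof (rule onorm_bound[OF K])
        fix h :: real
        have "norm (f' (y + s *\<^sub>R v) (h *\<^sub>R v)) = norm h * norm (f' (y + s *\<^sub>R v) v)"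
          by (simp add: scaleR)
        also have "\<dots> \<le> norm h * K" using s(2) by (intro mult_left_mono) auto
        finally show "norm (f' (y + s *\<^sub>R v) (h *\<^sub>R v)) \<le> K * norm h" by (simp add: mult.commute)
      qed
    qed (use t \<delta> in auto)
    then show ?thesis by simp
  qed
  with K \<delta> that show ?thesis by blast
qed

section \<open>Left-invariant fields and Haar measure\<close>

lemma Ck_on_Suc_imp_Ck_on_1: "Ck_on (Suc k) S f \<Longrightarrow> Ck_on (Suc 0) S f"
  by (auto intro: Ck_on_imp_continuous_on)

section \<open>Charts and continuity of the group operations\<close>

context compact_lie_group
begin

lemma in_carrier [simp]: "x \<in> carrier G"
  by (simp add: carrier_UNIV)

lemma chartD:
  assumes "(U, \<phi>) \<in> A"
  shows "open U" "open (\<phi> ` U)" "inj_on \<phi> U" "continuous_on U \<phi>"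
    "continuous_on (\<phi> ` U) (inv_into U \<phi>)"
proof -
  have *: "open U \<and> open (\<phi> ` U) \<and> homeomorphism U (\<phi> ` U) \<phi> (inv_into U \<phi>)"
    using atlas assms by (auto simp: smooth_atlas_def)
  then show "open U" "open (\<phi> ` U)" "continuous_on U \<phi>" "continuous_on (\<phi> ` U) (inv_into U \<phi>)"
    by (auto simp: homeomorphism_def)
  show "inj_on \<phi> U"
    using * by (intro inj_on_inverseI[of _ "inv_into U \<phi>"]) (auto simp: homeomorphism_def)
qed

lemma chart_exists: obtains U \<phi> where "(U, \<phi>) \<in> A" "g \<in> U"
proof -
  have "g \<in> (\<Union>(U, \<phi>)\<in>A. U)" using atlas by (simp add: smooth_atlas_def)
  with that show ?thesis by auto
qed

lemma continuous_on_group_mult: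
  assumes "continuous_on S f" "continuous_on S h"
  shows "continuous_on S (\<lambda>x. f x \<otimes> h x)"
proof -
  have "continuous_on UNIV (\<lambda>(x, y). x \<otimes> y)"
    using smooth_mult by (auto simp: smooth_map_def Ck_map_def)
  from continuous_on_compose2[OF this continuous_on_Pair[OF assms]] show ?thesis by simp
qed

lemma continuous_on_m_inv:
  assumes "continuous_on S f"
  shows "continuous_on S (\<lambda>x. inv (f x))"
proof -
  have "continuous_on UNIV (\<lambda>x. inv x)"
    using smooth_inv by (auto simp: smooth_map_def Ck_map_def)
  from continuous_on_compose2[OF this assms] show ?thesis by simp
qed

text \<open>The same chart \<open>U\<close> serves the first factor and the product, which suffices
  because the second factor will stay near the identity. \<open>S\<close> collects the coordinate
  pairs whose product is still in \<open>U\<close>.\<close>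

lemma Ck_on_mult_in_charts:
  assumes "(U, \<phi>) \<in> A" "(O', \<psi>) \<in> A"
  defines "S \<equiv> {p \<in> \<phi> ` U \<times> \<psi> ` O'. inv_into U \<phi> (fst p) \<otimes> inv_into O' \<psi> (snd p) \<in> U}"
  shows "open S" and "Ck_on k S (\<lambda>p. \<phi> (inv_into U \<phi> (fst p) \<otimes> inv_into O' \<psi> (snd p)))"
proof -
  note U = chartD[OF assms(1)] and O = chartD[OF assms(2)]
  have "continuous_on (\<phi> ` U \<times> \<psi> ` O') (\<lambda>p. inv_into U \<phi> (fst p) \<otimes> inv_into O' \<psi> (snd p))"
    by (intro continuous_on_group_mult continuous_on_compose2[OF U(5)] continuous_on_compose2[OF O(5)]
        continuous_intros) auto
  from continuous_open_preimage[OF this open_Times[OF U(2) O(2)] U(1)]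
  show oS: "open S" by (simp add: S_def vimage_def Int_def)
  have inv: "inv_into (U \<times> O') (map_prod \<phi> \<psi>) p = (inv_into U \<phi> (fst p), inv_into O' \<psi> (snd p))"
    if "p \<in> \<phi> ` U \<times> \<psi> ` O'" for p
    using that U(3) O(3) by (intro inv_into_f_eq) (auto simp: inj_on_def)
  have "S = map_prod \<phi> \<psi> ` (U \<times> O' \<inter> (\<lambda>(x, y). x \<otimes> y) -` U)"
    using U(3) O(3) by (auto simp: S_def image_iff Bex_def)
  moreover have "Ck_on k (map_prod \<phi> \<psi> ` (U \<times> O' \<inter> (\<lambda>(x, y). x \<otimes> y) -` U))
      (\<phi> \<circ> (\<lambda>(x, y). x \<otimes> y) \<circ> inv_into (U \<times> O') (map_prod \<phi> \<psi>))"
  proof -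
    have "(U \<times> O', map_prod \<phi> \<psi>) \<in> prod_atlas A A"
      using assms(1,2) by (auto simp: prod_atlas_def)
    then show ?thesis
      using smooth_mult assms(1) unfolding smooth_map_def Ck_map_def by fast
  qed
  ultimately have "Ck_on k S (\<phi> \<circ> (\<lambda>(x, y). x \<otimes> y) \<circ> inv_into (U \<times> O') (map_prod \<phi> \<psi>))"
    by simp
  then show "Ck_on k S (\<lambda>p. \<phi> (inv_into U \<phi> (fst p) \<otimes> inv_into O' \<psi> (snd p)))"
    by (rule Ck_on_cong[OF oS, rotated]) (auto simp: S_def inv)
qed

lemma Ck_map_chart:
  assumes "Ck_map k A vector_space_atlas f" "(U, \<phi>) \<in> A"
  shows "Ck_on k (\<phi> ` U) (f \<circ> inv_into U \<phi>)"
  using assms by (force simp: Ck_map_def vector_space_atlas_def)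

text \<open>Global continuity, a separate clause of \<open>Ck_map\<close>, follows from the chart
  expressions because the chart domains form an open cover.\<close>

lemma Ck_map_vector_space_iff:
  "Ck_map k A vector_space_atlas f \<longleftrightarrow> (\<forall>(U, \<phi>)\<in>A. Ck_on k (\<phi> ` U) (f \<circ> inv_into U \<phi>))"
proof
  assume R: "\<forall>(U, \<phi>)\<in>A. Ck_on k (\<phi> ` U) (f \<circ> inv_into U \<phi>)"
  have "continuous_on U f" if "(U, \<phi>) \<in> A" for U \<phi>
  proof -
    note U = chartD[OF that]
    have "continuous_on (\<phi> ` U) (f \<circ> inv_into U \<phi>)"
      using R that Ck_on_imp_continuous_on by blast
    then have "continuous_on U (\<lambda>x. (f \<circ> inv_into U \<phi>) (\<phi> x))"
      by (rule continuous_on_compose2[OF _ U(4)]) simp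
    then show ?thesis
      by (rule continuous_on_eq) (simp add: U(3))
  qed
  then have "continuous_on (\<Union>(U, \<phi>)\<in>A. U) f"
    by (intro continuous_on_open_UN) (auto dest: chartD)
  with R show "Ck_map k A vector_space_atlas f"
    using atlas by (auto simp: Ck_map_def vector_space_atlas_def smooth_atlas_def)
qed (auto dest: Ck_map_chart)

end

section \<open>Left-invariant fields in charts\<close>

locale lie_algebra_direction = compact_lie_group G A
  for G :: "('g::{t2_space, second_countable_topology}, 'm) monoid_scheme" (structure)
    and A :: "('g, 'e::real_inner) chart set" +
  fixes c :: "('g, 'e) chart" and v :: 'e
  assumes c_in_atlas: "c \<in> A" and one_in_c: "\<one> \<in> fst c"
begin

text \<open>Where the curve leaves the chart image, \<open>inv_into\<close> still returns some group
  element. Hence \<open>flow t\<close> is a right translation for every real \<open>t\<close>, so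
  continuity and invariance of integrals need no restriction on \<open>t\<close>.\<close>

definition flow :: "real \<Rightarrow> 'g \<Rightarrow> 'g" where
  "flow t g = g \<otimes> tangent_curve G c v t"

lemma c_chart: "(fst c, snd c) \<in> A"
  using c_in_atlas by simp

lemma tangent_curve_0 [simp]: "tangent_curve G c v 0 = \<one>"
  using chartD(3)[OF c_chart] one_in_c by (simp add: tangent_curve_def)

lemma flow_0 [simp]: "flow 0 g = g"
  by (simp add: flow_def)

lemma continuous_flow: "continuous_on UNIV (flow t)"
  unfolding flow_def by (intro continuous_on_group_mult continuous_intros)

definition chart_mult :: "'g set \<Rightarrow> ('g \<Rightarrow> 'e) \<Rightarrow> 'e \<times> 'e \<Rightarrow> 'e" where
  "chart_mult U \<phi> p = \<phi> (inv_into U \<phi> (fst p) \<otimes> inv_into (fst c) (snd c) (snd p))"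

definition chart_mult_dom :: "'g set \<Rightarrow> ('g \<Rightarrow> 'e) \<Rightarrow> ('e \<times> 'e) set" where
  "chart_mult_dom U \<phi> = {p \<in> \<phi> ` U \<times> snd c ` fst c.
     inv_into U \<phi> (fst p) \<otimes> inv_into (fst c) (snd c) (snd p) \<in> U}"

lemma chart_mult_one:
  assumes "(U, \<phi>) \<in> A" "x \<in> \<phi> ` U"
  shows "(x, snd c \<one>) \<in> chart_mult_dom U \<phi>" "chart_mult U \<phi> (x, snd c \<one>) = x"
  using assms chartD(3)[OF c_chart] one_in_c
  by (auto simp: chart_mult_def chart_mult_dom_def f_inv_into_f inv_into_into)

lemma chart_mult_flow:
  "\<phi> (flow t (inv_into U \<phi> x)) = chart_mult U \<phi> (x, snd c \<one> + t *\<^sub>R v)"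
  by (simp add: flow_def chart_mult_def tangent_curve_def)

lemma flow_in_chart:
  assumes "(x, snd c \<one> + t *\<^sub>R v) \<in> chart_mult_dom U \<phi>"
  shows "flow t (inv_into U \<phi> x) \<in> U"
  using assms by (simp add: chart_mult_dom_def flow_def tangent_curve_def)

lemma open_chart_mult_dom: "(U, \<phi>) \<in> A \<Longrightarrow> open (chart_mult_dom U \<phi>)"
  and Ck_on_chart_mult: "(U, \<phi>) \<in> A \<Longrightarrow> Ck_on k (chart_mult_dom U \<phi>) (chart_mult U \<phi>)"
  unfolding chart_mult_dom_def chart_mult_def
  using Ck_on_mult_in_charts[OF _ c_chart, of U \<phi>] by auto

text \<open>In coordinates the field is \<open>w\<close>, the differential of the multiplication in
  its second slot at the identity, and the field derivative of \<open>f\<close> is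
  \<open>n' x (w x)\<close>. As multiplication is smooth, one order of differentiability is lost
  through \<open>n'\<close> and none through \<open>w\<close>.\<close>

lemma left_inv_field_in_chart:
  assumes f: "Ck_map (Suc k) A vector_space_atlas f" and U: "(U, \<phi>) \<in> A"
  shows "\<And>g. g \<in> U \<Longrightarrow> ((\<lambda>t. f (flow t g)) has_vector_derivative left_inv_field G c v f g) (at 0)"
    and "Ck_on k (\<phi> ` U) (left_inv_field G c v f \<circ> inv_into U \<phi>)"
proof -
  note chart = chartD[OF U]
  define n where "n = f \<circ> inv_into U \<phi>"
  have "Ck_on (Suc k) (\<phi> ` U) n" unfolding n_def by (rule Ck_map_chart[OF f U])
  then obtain n' where n': "\<And>x. x \<in> \<phi> ` U \<Longrightarrow> (n has_derivative n' x) (at x)"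
    "\<And>u. Ck_on k (\<phi> ` U) (\<lambda>x. n' x u)" by auto
  obtain m' where m': "\<And>p. p \<in> chart_mult_dom U \<phi> \<Longrightarrow> (chart_mult U \<phi> has_derivative m' p) (at p)"
    "\<And>u. Ck_on k (chart_mult_dom U \<phi>) (\<lambda>p. m' p u)"
    using Ck_on_chart_mult[OF U, of "Suc k"] by auto
  define w where "w x = m' (x, snd c \<one>) (0, v)" for x
  have w: "Ck_on k (\<phi> ` U) w"
    unfolding w_def by (rule Ck_on_slice[OF chart_mult_one(1)[OF U] m'(2)])
  have deriv: "((\<lambda>t. f (flow t (inv_into U \<phi> x))) has_vector_derivative n' x (w x)) (at 0)"
    if x: "x \<in> \<phi> ` U" for x
  proof -
    note mx = chart_mult_one[OF U x]
    have "((\<lambda>t. chart_mult U \<phi> (x, snd c \<one> + t *\<^sub>R v)) has_derivative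
        (\<lambda>h. m' (x, snd c \<one>) (0, h *\<^sub>R v))) (at 0)"
      by (rule has_derivative_compose[where f="\<lambda>t. (x, snd c \<one> + t *\<^sub>R v)" and g="chart_mult U \<phi>"])
        (use m'(1)[OF mx(1)] in \<open>auto intro!: derivative_eq_intros\<close>)
    moreover have "m' (x, snd c \<one>) (0, h *\<^sub>R v) = h *\<^sub>R w x" for h
    proof -
      interpret bounded_linear "m' (x, snd c \<one>)"
        using m'(1)[OF mx(1)] by (rule has_derivative_bounded_linear)
      show ?thesis using scaleR[of h "(0, v)"] by (simp add: w_def)
    qed
    ultimately have "((\<lambda>t. chart_mult U \<phi> (x, snd c \<one> + t *\<^sub>R v)) has_derivative (\<lambda>h. h *\<^sub>R w x)) (at 0)"
      by simp
    then have "((\<lambda>t. n (chart_mult U \<phi> (x, snd c \<one> + t *\<^sub>R v))) has_derivative (\<lambda>h. n' x (h *\<^sub>R w x))) (at 0)"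
      by (rule has_derivative_compose) (use n'(1)[OF x] mx(2) in simp)
    moreover have "n' x (h *\<^sub>R w x) = h *\<^sub>R n' x (w x)" for h
      using n'(1)[OF x] by (simp add: linear_scale[OF has_derivative_linear])
    ultimately have *: "((\<lambda>t. n (chart_mult U \<phi> (x, snd c \<one> + t *\<^sub>R v))) has_vector_derivative n' x (w x)) (at 0)"
      by (simp add: has_vector_derivative_def)
    \<comment> \<open>Coordinates describe the flow only while the moved point stays in
      \<open>U\<close>; this holds on an open neighbourhood of \<open>t = 0\<close>, which is all
      that the derivative at 0 sees.\<close>
    show ?thesis
    proof (rule has_vector_derivative_transform_within_open[OF *])
      show "open ((\<lambda>t. (x, snd c \<one> + t *\<^sub>R v)) -` chart_mult_dom U \<phi>)"
        by (intro open_vimage open_chart_mult_dom[OF U] continuous_intros)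
      show "0 \<in> (\<lambda>t. (x, snd c \<one> + t *\<^sub>R v)) -` chart_mult_dom U \<phi>"
        using mx by simp
      fix t assume "t \<in> (\<lambda>t. (x, snd c \<one> + t *\<^sub>R v)) -` chart_mult_dom U \<phi>"
      then have "flow t (inv_into U \<phi> x) \<in> U" by (intro flow_in_chart) simp
      then show "n (chart_mult U \<phi> (x, snd c \<one> + t *\<^sub>R v)) = f (flow t (inv_into U \<phi> x))"
        by (simp add: chart_mult_flow[symmetric] n_def chart(3))
    qed
  qed
  have field: "left_inv_field G c v f (inv_into U \<phi> x) = n' x (w x)" if "x \<in> \<phi> ` U" for x
    using vector_derivative_at[OF deriv[OF that]] by (simp add: left_inv_field_def flow_def)
  show "((\<lambda>t. f (flow t g)) has_vector_derivative left_inv_field G c v f g) (at 0)" if "g \<in> U" for g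
    using deriv[of "\<phi> g"] field[of "\<phi> g"] that chart(3) by simp
  have "Ck_on k (\<phi> ` U) (\<lambda>x. n' x (w x))"
    using has_derivative_bounded_linear[OF n'(1)] by (intro Ck_on_directional[OF finite_dim _ n'(2) w chart(2)])
  then show "Ck_on k (\<phi> ` U) (left_inv_field G c v f \<circ> inv_into U \<phi>)"
    by (rule Ck_on_cong[OF chart(2), rotated]) (simp add: field)
qed

lemma Ck_map_left_inv_field:
  assumes "Ck_map (Suc k) A vector_space_atlas f"
  shows "Ck_map k A vector_space_atlas (left_inv_field G c v f)"
  using left_inv_field_in_chart(2)[OF assms] unfolding Ck_map_vector_space_iff by auto

text \<open>In a chart \<open>f (flow t g)\<close> is \<open>n\<close> applied to
  \<open>chart_mult\<close>, so the constant is that of \<open>n\<close> times that of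
  \<open>chart_mult\<close> in the direction \<open>(0, v)\<close>. The radii keep both arguments of
  \<open>n\<close> in the ball where its constant is valid.\<close>

lemma flow_locally_lipschitz:
  assumes f: "Ck_map (Suc 0) A vector_space_atlas f"
  shows "\<exists>N K \<delta>. open N \<and> g\<^sub>0 \<in> N \<and> K \<ge> 0 \<and> \<delta> > 0 \<and>
    (\<forall>g\<in>N. \<forall>t. \<bar>t\<bar> < \<delta> \<longrightarrow> norm (f (flow t g) - f g) \<le> K * \<bar>t\<bar>)"
proof -
  obtain U \<phi> where U: "(U, \<phi>) \<in> A" and g0: "g\<^sub>0 \<in> U" by (rule chart_exists)
  note chart = chartD[OF U]
  define n where "n = f \<circ> inv_into U \<phi>"
  define x0 where "x0 = \<phi> g\<^sub>0"
  have x0: "x0 \<in> \<phi> ` U" using g0 by (simp add: x0_def)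
  have "Ck_on (Suc 0) (\<phi> ` U) n" unfolding n_def by (rule Ck_map_chart[OF f U])
  then obtain K1 \<delta>1 where n: "K1 \<ge> 0" "\<delta>1 > 0" "ball x0 \<delta>1 \<subseteq> \<phi> ` U"
    "\<And>y z. y \<in> ball x0 \<delta>1 \<Longrightarrow> z \<in> ball x0 \<delta>1 \<Longrightarrow> norm (n y - n z) \<le> K1 * norm (y - z)"
    using Ck_on_1_locally_lipschitz[OF finite_dim _ chart(2) x0] by metis
  define p where "p = (x0, snd c \<one>)"
  have p: "p \<in> chart_mult_dom U \<phi>" and mp: "chart_mult U \<phi> p = x0"
    unfolding p_def by (rule chart_mult_one[OF U x0])+
  obtain K2 \<delta>2 where m: "K2 \<ge> 0" "\<delta>2 > 0"
    "\<And>q t. q \<in> ball p \<delta>2 \<Longrightarrow> \<bar>t\<bar> < \<delta>2 \<Longrightarrow>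
       norm (chart_mult U \<phi> (q + t *\<^sub>R (0, v)) - chart_mult U \<phi> q) \<le> K2 * \<bar>t\<bar>"
    using Ck_on_1_directional_lipschitz[OF Ck_on_chart_mult[OF U] open_chart_mult_dom[OF U] p, of "(0, v)"]
    by metis
  have "open (chart_mult_dom U \<phi> \<inter> chart_mult U \<phi> -` ball x0 \<delta>1)"
    by (intro continuous_open_preimage open_chart_mult_dom[OF U] open_ball
        Ck_on_imp_continuous_on[OF Ck_on_chart_mult[OF U, of 0]])
  moreover have "p \<in> chart_mult_dom U \<phi> \<inter> chart_mult U \<phi> -` ball x0 \<delta>1"
    using p mp n(2) by simp
  ultimately obtain \<delta>3 where \<delta>3: "\<delta>3 > 0" "ball p \<delta>3 \<subseteq> chart_mult_dom U \<phi> \<inter> chart_mult U \<phi> -` ball x0 \<delta>1"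
    by (meson open_contains_ball)
  \<comment> \<open>Half of the common radius is left to the base point and half to the displacement
    \<open>t *\<^sub>R v\<close>. Dividing by \<open>1 + norm v\<close> rather than
    \<open>norm v\<close> allows \<open>v = 0\<close> and ensures \<delta> \<le> \<epsilon>.\<close>
  define \<epsilon> where "\<epsilon> = min \<delta>2 \<delta>3 / 2"
  define \<delta> where "\<delta> = \<epsilon> / (1 + norm v)"
  have v1: "1 + norm v > 0" "1 + norm v \<ge> 1" by (auto simp: add_pos_nonneg)
  have \<epsilon>: "\<epsilon> > 0" "2 * \<epsilon> \<le> \<delta>2" "2 * \<epsilon> \<le> \<delta>3" using m(2) \<delta>3(1) by (auto simp: \<epsilon>_def)
  have "\<delta> \<le> \<epsilon>" using \<epsilon>(1) v1 frac_le[of \<epsilon> \<epsilon> 1 "1 + norm v"] by (simp add: \<delta>_def)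
  then have \<delta>: "\<delta> > 0" "\<delta> \<le> \<delta>2" using \<epsilon> divide_pos_pos[OF \<epsilon>(1) v1(1)] by (auto simp: \<delta>_def)
  have near: "(x, snd c \<one> + t *\<^sub>R v) \<in> ball p (2 * \<epsilon>)" if x: "x \<in> ball x0 \<epsilon>" and t: "\<bar>t\<bar> < \<delta>" for x t
  proof -
    have "norm ((x, snd c \<one> + t *\<^sub>R v) - p) = norm (x - x0, t *\<^sub>R v)"
      by (simp add: p_def)
    also have "\<dots> \<le> norm (x - x0) + norm (t *\<^sub>R v)" by (rule norm_Pair_le)
    also have "\<dots> < \<epsilon> + \<epsilon>"
    proof (rule add_strict_mono)
      show "norm (x - x0) < \<epsilon>" using x by (simp add: dist_norm norm_minus_commute)
      have "norm (t *\<^sub>R v) \<le> \<bar>t\<bar> * (1 + norm v)" by (simp add: distrib_left)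
      also have "\<dots> < \<delta> * (1 + norm v)" using t v1(1) by (rule mult_strict_right_mono)
      also have "\<dots> = \<epsilon>" using v1(1) by (simp add: \<delta>_def less_imp_neq[THEN not_sym])
      finally show "norm (t *\<^sub>R v) < \<epsilon>" .
    qed
    finally show ?thesis by (simp add: dist_norm norm_minus_commute)
  qed
  define N where "N = U \<inter> \<phi> -` ball x0 \<epsilon>"
  have "open N" unfolding N_def by (intro continuous_open_preimage chart open_ball)
  moreover have "g\<^sub>0 \<in> N" using g0 \<epsilon>(1) by (simp add: N_def x0_def)
  moreover have "norm (f (flow t g) - f g) \<le> K1 * K2 * \<bar>t\<bar>" if g: "g \<in> N" and t: "\<bar>t\<bar> < \<delta>" for g t
  proof -
    define x where "x = \<phi> g"
    have x: "x \<in> ball x0 \<epsilon>" "x \<in> \<phi> ` U" and gx: "g = inv_into U \<phi> x"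
      using g chart(3) by (auto simp: N_def x_def)
    define y where "y = chart_mult U \<phi> (x, snd c \<one> + t *\<^sub>R v)"
    have xy: "(x, snd c \<one> + s *\<^sub>R v) \<in> ball p \<delta>2" "(x, snd c \<one> + s *\<^sub>R v) \<in> chart_mult_dom U \<phi>"
      "chart_mult U \<phi> (x, snd c \<one> + s *\<^sub>R v) \<in> ball x0 \<delta>1" if "\<bar>s\<bar> < \<delta>" for s
      using near[OF x(1) that] \<epsilon>(2,3) \<delta>3(2) by (auto simp: subset_iff)
    have m0: "chart_mult U \<phi> (x, snd c \<one>) = x" by (rule chart_mult_one(2)[OF U x(2)])
    have "f (flow t g) = n y"
      using flow_in_chart[OF xy(2)[OF t]] chart(3)
      unfolding n_def y_def chart_mult_flow[symmetric] gx by simp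
    moreover have "f g = n x" by (simp add: n_def gx)
    moreover have "norm (n y - n x) \<le> K1 * norm (y - x)"
      using xy(3)[OF t] xy(3)[of 0] m0 \<delta>(1) unfolding y_def by (intro n(4)) auto
    moreover have "norm (y - x) \<le> K2 * \<bar>t\<bar>"
      using m(3)[of "(x, snd c \<one>)" t] xy(1)[of 0] m0 t \<delta> by (simp add: y_def)
    ultimately show ?thesis
      using mult_left_mono[OF _ n(1), of "norm (y - x)" "K2 * \<bar>t\<bar>"] by (simp add: mult.assoc)
  qed
  moreover have "K1 * K2 \<ge> 0" using n m by simp
  ultimately show ?thesis using \<delta>(1) by blast
qed

text \<open>Compactness turns the local Lipschitz bounds into a uniform one; as the local constants
  are nonnegative, their sum over a finite subcover is a common constant.\<close>

lemma flow_C1_left_inv_field: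
  assumes f: "Ck_map (Suc k) A vector_space_atlas f"
  shows "flow_C1 flow f (left_inv_field G c v f)"
proof -
  have cont: "continuous_on UNIV f" "continuous_on UNIV (left_inv_field G c v f)"
    using f Ck_map_left_inv_field[OF f] by (auto simp: Ck_map_def)
  have deriv: "((\<lambda>t. f (flow t g)) has_vector_derivative left_inv_field G c v f g) (at 0)" for g
    using chart_exists[of g] left_inv_field_in_chart(1)[OF f] by blast
  have f1: "Ck_map (Suc 0) A vector_space_atlas f"
    unfolding Ck_map_vector_space_iff using Ck_map_chart[OF f, THEN Ck_on_Suc_imp_Ck_on_1] by blast
  obtain N K \<delta> where N: "\<And>g. open (N g)" "\<And>g. g \<in> N g" "\<And>g. K g \<ge> 0" "\<And>g. \<delta> g > (0::real)"
    "\<And>g0 g t. g \<in> N g0 \<Longrightarrow> \<bar>t\<bar> < \<delta> g0 \<Longrightarrow> norm (f (flow t g) - f g) \<le> K g0 * \<bar>t\<bar>"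
    using flow_locally_lipschitz[OF f1] by metis
  obtain D where D: "finite D" "UNIV \<subseteq> (\<Union>g\<in>D. N g)"
    by (rule compactE_image[OF compact_UNIV, of UNIV N]) (use N(1,2) in auto)
  have "\<forall>\<^sub>F t in at 0. \<forall>g0\<in>D. \<bar>t\<bar> < \<delta> g0"
  proof (intro eventually_ball_finite D(1) ballI)
    fix g0
    show "\<forall>\<^sub>F t in at 0. \<bar>t\<bar> < \<delta> g0"
      using N(4)[of g0] by (auto simp: eventually_at dist_norm)
  qed
  then have "\<forall>\<^sub>F t in at 0. \<forall>g. norm (f (flow t g) - f g) \<le> (\<Sum>g0\<in>D. K g0) * \<bar>t\<bar>"
  proof eventually_elim
    case (elim t)
    show ?case
    proof
      fix g
      obtain g0 where g0: "g0 \<in> D" "g \<in> N g0" using D(2) by auto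
      then have "norm (f (flow t g) - f g) \<le> K g0 * \<bar>t\<bar>" using N(5) elim by auto
      also have "\<dots> \<le> (\<Sum>g0\<in>D. K g0) * \<bar>t\<bar>"
        using D(1) g0(1) N(3) by (intro mult_right_mono member_le_sum) auto
      finally show "norm (f (flow t g) - f g) \<le> (\<Sum>g0\<in>D. K g0) * \<bar>t\<bar>" .
    qed
  qed
  moreover have "(\<Sum>g0\<in>D. K g0) \<ge> 0" using N(3) by (intro sum_nonneg) auto
  ultimately show ?thesis using cont deriv by (auto simp: flow_C1_def)
qed

end

section \<open>Right invariance of Haar measure\<close>

context compact_lie_group
begin

text \<open>Invariance under inversion comes from integrating \<open>u (inv x \<otimes> y)\<close>
  over both variables: left invariance in \<open>y\<close> gives the integral of \<open>u\<close>,
  and in the other order left invariance in \<open>x\<close> gives that of \<open>u (inv x)\<close>.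
  Right translation is left translation conjugated by inversion.\<close>

lemma haar_right_invariant:
  fixes f :: "'g \<Rightarrow> 'b::{banach, second_countable_topology}"
  assumes M: "normalized_haar G M" and f: "continuous_on UNIV f"
  shows "(\<integral>x. f (x \<otimes> h) \<partial>M) = (\<integral>x. f x \<partial>M)"
proof -
  interpret prob_space M using M by (simp add: normalized_haar_def)
  have sets: "sets M = sets borel" using M by (simp add: normalized_haar_def)
  have space: "space M = UNIV" using sets_eq_imp_space_eq[OF sets] by simp
  have m1: "measure M (space M) = 1" by (rule prob_space)
  have left: "(\<integral>x. u (g \<otimes> x) \<partial>M) = (\<integral>x. u x \<partial>M)" if u: "continuous_on UNIV u"
    for g and u :: "'g \<Rightarrow> 'b"
  proof -
    have [measurable]: "(\<lambda>x. g \<otimes> x) \<in> measurable M M"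
      unfolding measurable_cong_sets[OF sets sets]
      by (intro borel_measurable_continuous_onI continuous_on_group_mult continuous_intros)
    have [measurable]: "u \<in> borel_measurable M"
      unfolding measurable_cong_sets[OF sets refl] by (rule borel_measurable_continuous_onI[OF u])
    have "distr M M (\<lambda>x. g \<otimes> x) = M"
    proof (rule measure_eqI)
      fix S assume "S \<in> sets (distr M M (\<lambda>x. g \<otimes> x))"
      then have S: "S \<in> sets M" by simp
      \<comment> \<open>\<open>normalized_haar\<close> speaks of images and \<open>distr\<close> of
        preimages; they meet by passing to the inverse element.\<close>
      have img: "(\<lambda>x. inv g \<otimes> x) ` S = (\<lambda>x. g \<otimes> x) -` S"
      proof (intro equalityI subsetI)
        fix y assume "y \<in> (\<lambda>x. g \<otimes> x) -` S"
        then show "y \<in> (\<lambda>x. inv g \<otimes> x) ` S"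
          by (intro image_eqI[of _ _ "g \<otimes> y"]) (simp_all add: m_assoc[symmetric])
      qed (auto simp: m_assoc[symmetric])
      have "emeasure (distr M M (\<lambda>x. g \<otimes> x)) S = emeasure M ((\<lambda>x. inv g \<otimes> x) ` S)"
        using S by (simp add: emeasure_distr space img)
      also have "\<dots> = emeasure M S"
        using M S by (simp add: normalized_haar_def)
      finally show "emeasure (distr M M (\<lambda>x. g \<otimes> x)) S = emeasure M S" .
    qed simp
    then show ?thesis using integral_distr[of "\<lambda>x. g \<otimes> x" M M u] by simp
  qed
  have inv: "(\<integral>x. u x \<partial>M) = (\<integral>x. u (inv x) \<partial>M)" if u: "continuous_on UNIV u" for u :: "'g \<Rightarrow> 'b"
  proof -
    interpret pair_prob_space M M by unfold_locales
    define F where "F = (\<lambda>x y. u (inv x \<otimes> y))"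
    have cF: "continuous_on UNIV (case_prod F)"
      unfolding F_def case_prod_unfold
      by (intro continuous_on_compose2[OF u] continuous_on_group_mult continuous_on_m_inv continuous_intros) auto
    \<comment> \<open>Second countability makes the product of the Borel algebras the Borel algebra
      of the product, so that continuity of \<open>F\<close> gives the joint integrability needed by
      Fubini.\<close>
    have "sets (M \<Otimes>\<^sub>M M) = sets borel"
      using sets_pair_measure_cong[OF sets sets] unfolding borel_prod .
    moreover have "compact (UNIV :: ('g \<times> 'g) set)"
      using compact_Times[OF compact_UNIV compact_UNIV] by simp
    ultimately have int: "integrable (M \<Otimes>\<^sub>M M) (case_prod F)"
      using cF by (intro integrable_continuous_compact) (auto intro: P.finite_measure_axioms)
    have "(\<integral>x. u x \<partial>M) = (\<integral>x. (\<integral>y. F x y \<partial>M) \<partial>M)"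
      by (simp add: F_def left[OF u] m1)
    also have "\<dots> = (\<integral>y. (\<integral>x. F x y \<partial>M) \<partial>M)"
      by (rule Fubini_integral[OF int, symmetric])
    also have "\<dots> = (\<integral>y. (\<integral>x. u (inv x) \<partial>M) \<partial>M)"
    proof (rule Bochner_Integration.integral_cong[OF refl])
      fix y
      have c: "continuous_on UNIV (\<lambda>x. u (inv x))"
        by (intro continuous_on_compose2[OF u] continuous_on_m_inv continuous_intros) auto
      have "(\<integral>x. F x y \<partial>M) = (\<integral>x. u (inv (inv y \<otimes> x)) \<partial>M)"
        by (simp add: F_def inv_mult_group)
      also have "\<dots> = (\<integral>x. u (inv x) \<partial>M)" by (rule left[OF c])
      finally show "(\<integral>x. F x y \<partial>M) = (\<integral>x. u (inv x) \<partial>M)" .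
    qed
    also have "\<dots> = (\<integral>x. u (inv x) \<partial>M)" by (simp add: m1)
    finally show ?thesis .
  qed
  have c: "continuous_on UNIV (\<lambda>x. f (inv x))" "continuous_on UNIV (\<lambda>x. f (x \<otimes> h))"
    by (intro continuous_on_compose2[OF f] continuous_on_m_inv continuous_on_group_mult continuous_intros; simp)+
  have "(\<integral>x. f (x \<otimes> h) \<partial>M) = (\<integral>x. f (inv (inv h \<otimes> x)) \<partial>M)"
    using inv[OF c(2)] by (simp add: inv_mult_group)
  also have "\<dots> = (\<integral>x. f (inv x) \<partial>M)" by (rule left[OF c(1)])
  also have "\<dots> = (\<integral>x. f x \<partial>M)" by (rule inv[OF f, symmetric])
  finally show ?thesis .
qed

end

section \<open>Derivatives of Wilson loops\<close>

lemma bounded_bilinear_matrix_mult: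
  "bounded_bilinear (\<lambda>(X :: complex ^ 'n ^ 'm) (Y :: complex ^ 'k ^ 'n). X ** Y)"
proof -
  have "bilinear (\<lambda>(X :: complex ^ 'n ^ 'm) (Y :: complex ^ 'k ^ 'n). X ** Y)"
    unfolding bilinear_def
    by (auto intro!: linearI simp: vec_eq_iff matrix_matrix_mult_def scaleR_sum_right
        distrib_left distrib_right sum.distrib)
  then show ?thesis by (simp only: bilinear_conv_bounded_bilinear)
qed

lemma bounded_linear_trace: "bounded_linear (trace :: complex ^ 'n ^ 'n \<Rightarrow> complex)"
  unfolding linear_conv_bounded_linear[symmetric]
  by (auto intro!: linearI simp: trace_add) (simp add: trace_def scaleR_sum_right)

lemmas matrix_mult_simps =
  bounded_bilinear.add_left[OF bounded_bilinear_matrix_mult]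
  bounded_bilinear.add_right[OF bounded_bilinear_matrix_mult]
  bounded_bilinear.sum_left[OF bounded_bilinear_matrix_mult]
  bounded_bilinear.sum_right[OF bounded_bilinear_matrix_mult]
  bounded_bilinear.minus_left[OF bounded_bilinear_matrix_mult]
  bounded_bilinear.minus_right[OF bounded_bilinear_matrix_mult]
  bounded_bilinear.diff_left[OF bounded_bilinear_matrix_mult]
  bounded_bilinear.diff_right[OF bounded_bilinear_matrix_mult]

lemmas trace_sum = linear_sum[OF bounded_linear.linear[OF bounded_linear_trace]]

lemma flow_C1_matrix_mult:
  fixes f :: "'g::topological_space \<Rightarrow> complex ^ 'n ^ 'm" and h :: "'g \<Rightarrow> complex ^ 'k ^ 'n"
  assumes "compact (UNIV :: 'g set)" "flow_C1 \<Phi> f f'" "flow_C1 \<Phi> h h'"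
  shows "flow_C1 \<Phi> (\<lambda>g. f g ** h g) (\<lambda>g. f' g ** h g + f g ** h' g)"
  using assms by (rule flow_C1_bilinear[OF _ _ _ bounded_bilinear_matrix_mult])

section \<open>Cyclic order of the positions in a loop\<close>

lemma rotate_eq_drop_take: "k \<le> length xs \<Longrightarrow> rotate k xs = drop k xs @ take k xs"
  by (cases "k = length xs") (auto simp: rotate_drop_take)

text \<open>\<open>j'\<close> is reached from \<open>j\<close> by skipping \<open>i\<close>
  positions. The last two facts count the factors strictly between, in the form
  \<open>loop_segment\<close> uses; the counts add up to \<open>n - 2\<close> because
  \<open>j\<close> and \<open>j'\<close> are left out.\<close>

lemma mod_cyclic_between:
  assumes "i < n - 1" "j < (n::nat)" "j' = (Suc j + i) mod n"
  shows "j' < n" "j' \<noteq> j" "(j' + n - j - 1) mod n = i" "(j + n - j' - 1) mod n = n - 2 - i"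
proof -
  show "j' < n" using assms by simp
  have "j' = (if Suc j + i < n then Suc j + i else Suc j + i - n)"
    using assms by (simp add: mod_if)
  then show "j' \<noteq> j" "(j' + n - j - 1) mod n = i" "(j + n - j' - 1) mod n = n - 2 - i"
    using assms(1,2) by (auto simp: mod_if split: if_splits)
qed

text \<open>Translates the numbering of a word cut open after \<open>j\<close> into positions of the
  loop; the inverse map counts the factors in between.\<close>

lemma bij_betw_cyclic_shift:
  assumes "j < (n::nat)"
  shows "bij_betw (\<lambda>i. (Suc j + i) mod n) {..<n - 1} ({..<n} - {j})"
proof (rule bij_betw_byWitness[where f'="\<lambda>j'. (j' + n - j - 1) mod n"])
  show "\<forall>j'\<in>{..<n} - {j}. (Suc j + (j' + n - j - 1) mod n) mod n = j'"
  proof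
    fix j' assume j': "j' \<in> {..<n} - {j}"
    have "(Suc j + (j' + n - j - 1) mod n) mod n = (Suc j + (j' + n - j - 1)) mod n"
      by (rule mod_add_right_eq)
    also have "Suc j + (j' + n - j - 1) = j' + n" using assms by simp
    finally show "(Suc j + (j' + n - j - 1) mod n) mod n = j'" using j' by simp
  qed
  show "(\<lambda>j'. (j' + n - j - 1) mod n) ` ({..<n} - {j}) \<subseteq> {..<n - 1}"
    using assms by (auto simp: mod_if)
qed (use mod_cyclic_between[OF _ assms refl] in auto)

section \<open>The representation and Wilson loops along one direction\<close>

locale rep_direction = lie_algebra_direction G A c v
  for G :: "('g::{t2_space, second_countable_topology}, 'm) monoid_scheme" (structure)
    and A :: "('g, 'e::real_inner) chart set" and c v +
  fixes \<rho> :: "'g \<Rightarrow> complex ^ 'n ^ 'n"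
  assumes rep: "lie_group_rep G A \<rho>"
begin

abbreviation R where "R \<equiv> induced_rep G c \<rho> v"

abbreviation ins where "ins \<equiv> insertion G c \<rho> v"

abbreviation seg where "seg \<equiv> loop_segment G \<rho>"

lemma rep_one [simp]: "\<rho> \<one> = mat 1"
  and rep_mult: "\<rho> (x \<otimes> y) = \<rho> x ** \<rho> y"
  using rep by (auto simp: lie_group_rep_def)

text \<open>The homomorphism property splits off the constant matrix \<open>\<rho> g\<close> and
  moves differentiation to the identity. Since \<rho> is differentiable along the curve there,
  \<open>R\<close> is a genuine derivative and not a default value of
  \<open>vector_derivative\<close>.\<close>

lemma flow_C1_rep: "flow_C1 flow \<rho> (\<lambda>g. \<rho> g ** R)"
proof -
  have "Ck_map (Suc 0) A vector_space_atlas \<rho>"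
    using rep by (simp add: lie_group_rep_def smooth_map_def)
  then have *: "flow_C1 flow \<rho> (left_inv_field G c v \<rho>)" by (rule flow_C1_left_inv_field)
  have d: "((\<lambda>t. \<rho> (flow t g)) has_vector_derivative left_inv_field G c v \<rho> g) (at 0)" for g
    using * by (simp add: flow_C1_def)
  have "((\<lambda>t. \<rho> (tangent_curve G c v t)) has_vector_derivative left_inv_field G c v \<rho> \<one>) (at 0)"
    using d[of \<one>] by (simp add: flow_def)
  then have "((\<lambda>t. \<rho> (tangent_curve G c v t)) has_vector_derivative R) (at 0)"
    unfolding induced_rep_def using vector_derivative_works differentiableI_vector by blast
  then have "((\<lambda>t. \<rho> (flow t g)) has_vector_derivative \<rho> g ** R) (at 0)" for g
    unfolding flow_def rep_mult
    by (rule bounded_linear.has_vector_derivative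
        [OF bounded_bilinear.bounded_linear_right[OF bounded_bilinear_matrix_mult]])
  then have "left_inv_field G c v \<rho> = (\<lambda>g. \<rho> g ** R)"
    using d vector_derivative_unique_at by blast
  with * show ?thesis by simp
qed

lemma rep_inv_mult [simp]: "\<rho> (inv x) ** \<rho> x = mat 1"
  by (simp add: rep_mult[symmetric])

text \<open>Differentiability of \<open>\<lambda>g. \<rho> (inv g)\<close> is reduced to that of \<open>\<rho>\<close> by
  \<open>\<rho> h\<inverse> - 1 = - \<rho> h\<inverse> (\<rho> h - 1)\<close>, where the first factor is merely continuous.\<close>

lemma flow_C1_rep_inv: "flow_C1 flow (\<lambda>g. \<rho> (inv g)) (\<lambda>g. - (R ** \<rho> (inv g)))"
proof -
  note r = flow_C1_rep
  have cont\<rho>: "continuous_on UNIV \<rho>" by (rule flow_C1_continuous[OF r])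
  have cont: "continuous_on UNIV (\<lambda>g. \<rho> (inv g))"
    by (intro continuous_on_compose2[OF cont\<rho>] continuous_on_m_inv continuous_intros) auto
  let ?\<gamma> = "tangent_curve G c v"
  have key: "\<rho> (inv (flow t g)) - \<rho> (inv g) = - (\<rho> (inv (?\<gamma> t)) ** ((\<rho> (?\<gamma> t) - mat 1) ** \<rho> (inv g)))" for t g
  proof -
    let ?N = "\<rho> (inv (?\<gamma> t))" and ?M = "\<rho> (?\<gamma> t)" and ?Q = "\<rho> (inv g)"
    have "?N ** ((?M - mat 1) ** ?Q) = ?N ** ?M ** ?Q - ?N ** ?Q"
      by (simp only: bounded_bilinear.diff_left[OF bounded_bilinear_matrix_mult]
          bounded_bilinear.diff_right[OF bounded_bilinear_matrix_mult] matrix_mul_assoc matrix_mul_lid)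
    also have "\<dots> = ?Q - \<rho> (inv (flow t g))"
      by (simp only: flow_def inv_mult_group in_carrier rep_mult rep_inv_mult matrix_mul_lid)
    finally show ?thesis by (simp only: minus_diff_eq)
  qed
  have flow1: "flow t \<one> = ?\<gamma> t" for t by (simp add: flow_def)
  have d1: "((\<lambda>t. \<rho> (?\<gamma> t)) has_vector_derivative R) (at 0)"
  proof -
    have "((\<lambda>t. \<rho> (flow t \<one>)) has_vector_derivative \<rho> \<one> ** R) (at 0)"
      using r unfolding flow_C1_def by blast
    then show ?thesis by (simp add: flow1)
  qed
  then have q1: "((\<lambda>t. (\<rho> (?\<gamma> t) - mat 1) /\<^sub>R t) \<longlongrightarrow> R) (at 0)"
    by (simp add: has_vector_derivative_at_0_iff)
  have inv_lim: "((\<lambda>t. \<rho> (inv (?\<gamma> t))) \<longlongrightarrow> mat 1) (at 0)"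
  proof -
    have "continuous_on (snd c ` fst c) (inv_into (fst c) (snd c))" "open (snd c ` fst c)"
      using chartD[OF c_chart] by auto
    then have "isCont (inv_into (fst c) (snd c)) (snd c \<one>)"
      using one_in_c by (simp add: continuous_on_eq_continuous_at)
    then have "isCont (inv_into (fst c) (snd c)) (snd c \<one> + 0 *\<^sub>R v)" by simp
    then have "isCont ?\<gamma> 0"
      unfolding tangent_curve_def[abs_def] by (rule isCont_o2[where f="\<lambda>t. snd c \<one> + t *\<^sub>R v", rotated]) simp
    moreover have "isCont (\<lambda>g. \<rho> (inv g)) (?\<gamma> 0)"
      using cont continuous_on_eq_continuous_at by blast
    ultimately have "isCont (\<lambda>t. \<rho> (inv (?\<gamma> t))) 0" by (rule isCont_o2)
    then show ?thesis by (simp add: isCont_def)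
  qed
  have deriv: "((\<lambda>t. \<rho> (inv (flow t g))) has_vector_derivative - (R ** \<rho> (inv g))) (at 0)" for g
  proof -
    have "((\<lambda>t. - (\<rho> (inv (?\<gamma> t)) ** (((\<rho> (?\<gamma> t) - mat 1) /\<^sub>R t) ** \<rho> (inv g)))) \<longlongrightarrow>
        - (mat 1 ** (R ** \<rho> (inv g)))) (at 0)"
      by (intro tendsto_minus bounded_bilinear.tendsto[OF bounded_bilinear_matrix_mult]
          inv_lim q1 tendsto_const)
    moreover have "(\<rho> (inv (flow t g)) - \<rho> (inv (flow 0 g))) /\<^sub>R t =
        - (\<rho> (inv (?\<gamma> t)) ** (((\<rho> (?\<gamma> t) - mat 1) /\<^sub>R t) ** \<rho> (inv g)))" for t
      by (simp only: flow_0 key scaleR_minus_right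
          bounded_bilinear.scaleR_left[OF bounded_bilinear_matrix_mult]
          bounded_bilinear.scaleR_right[OF bounded_bilinear_matrix_mult])
    ultimately show ?thesis by (simp add: has_vector_derivative_at_0_iff)
  qed
  obtain C where C: "C > 0" "\<And>(X :: complex^'n^'n) (Y :: complex^'n^'n). norm (X ** Y) \<le> norm X * norm Y * C"
    using bounded_bilinear.pos_bounded[OF bounded_bilinear_matrix_mult] by blast
  obtain b where b: "\<And>g. norm (\<rho> (inv g)) \<le> b"
    using compact_imp_bounded[OF compact_continuous_image[OF cont compact_UNIV]] by (auto simp: bounded_iff)
  have b0: "b \<ge> 0" using norm_ge_zero b by (rule order_trans)
  obtain K where K: "K \<ge> 0" "\<forall>\<^sub>F t in at 0. \<forall>g. norm (\<rho> (flow t g) - \<rho> g) \<le> K * \<bar>t\<bar>"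
    using r by (auto simp: flow_C1_def)
  from K(2) have "\<forall>\<^sub>F t in at 0. \<forall>g. norm (\<rho> (inv (flow t g)) - \<rho> (inv g)) \<le> (b * (K * b * C) * C) * \<bar>t\<bar>"
  proof eventually_elim
    case (elim t)
    have t: "norm (\<rho> (?\<gamma> t) - mat 1) \<le> K * \<bar>t\<bar>"
      using elim[THEN spec, of \<one>] by (simp add: flow1)
    show ?case
    proof
      fix g
      have "norm (\<rho> (inv (flow t g)) - \<rho> (inv g)) \<le>
          norm (\<rho> (inv (?\<gamma> t))) * norm ((\<rho> (?\<gamma> t) - mat 1) ** \<rho> (inv g)) * C"
        unfolding key norm_minus_cancel by (rule C(2))
      also have "norm ((\<rho> (?\<gamma> t) - mat 1) ** \<rho> (inv g)) \<le> (K * \<bar>t\<bar>) * b * C"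
        using C(1) b0 K(1) t b[of g] by (intro order_trans[OF C(2)] mult_right_mono mult_mono) auto
      also have "norm (\<rho> (inv (?\<gamma> t))) * ((K * \<bar>t\<bar>) * b * C) * C \<le> b * ((K * \<bar>t\<bar>) * b * C) * C"
        using C(1) b0 K(1) b by (intro mult_right_mono) auto
      finally show "norm (\<rho> (inv (flow t g)) - \<rho> (inv g)) \<le> (b * (K * b * C) * C) * \<bar>t\<bar>"
        using C(1) by (simp add: mult_ac mult_right_mono mult_left_mono)
    qed
  qed
  moreover have "b * (K * b * C) * C \<ge> 0" using b0 K(1) C(1) by simp
  moreover have "continuous_on UNIV (\<lambda>g. - (R ** \<rho> (inv g)))"
    by (intro continuous_intros bounded_bilinear.continuous_on[OF bounded_bilinear_matrix_mult] cont)
  ultimately show ?thesis using cont deriv unfolding flow_C1_def by auto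
qed

lemma int_pow_minus_one: "g [^] (- 1 :: int) = inv g"
  using int_pow_neg[of g 1] by simp

lemma flow_C1_rep_int_pow:
  assumes "\<sigma> \<in> {1, - 1}"
  shows "flow_C1 flow (\<lambda>g. \<rho> (g [^] \<sigma>)) (ins \<sigma>)"
  using assms flow_C1_rep flow_C1_rep_inv by (auto simp: insertion_def[abs_def] int_pow_minus_one)

text \<open>The second derivative of \<open>\<rho> (g [^] \<sigma>)\<close> for the two admissible
  signs; for the inverse the two minus signs cancel. The factors \<open>R ** R\<close> are adjacent,
  which lets the Casimir matrix form in the basis sum.\<close>

definition ins2 :: "int \<Rightarrow> 'g \<Rightarrow> complex ^ 'n ^ 'n" where
  "ins2 \<sigma> g = (if \<sigma> = 1 then \<rho> g ** (R ** R) else (R ** R) ** \<rho> (inv g))"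

lemma flow_C1_ins: "flow_C1 flow (ins \<sigma>) (ins2 \<sigma>)"
proof (cases "\<sigma> = 1")
  case True
  have "flow_C1 flow (\<lambda>g. \<rho> g ** R) (\<lambda>g. \<rho> g ** R ** R)"
    by (rule flow_C1_bounded_linear[OF flow_C1_rep
        bounded_bilinear.bounded_linear_left[OF bounded_bilinear_matrix_mult]])
  then show ?thesis by (simp add: True insertion_def[abs_def] ins2_def[abs_def] matrix_mul_assoc)
next
  case False
  have "flow_C1 flow (\<lambda>g. - (R ** \<rho> (inv g))) (\<lambda>g. - (R ** - (R ** \<rho> (inv g))))"
    by (rule flow_C1_bounded_linear[OF flow_C1_rep_inv bounded_linear_minus
        [OF bounded_bilinear.bounded_linear_right[OF bounded_bilinear_matrix_mult]]])
  then show ?thesis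
    by (simp add: False insertion_def[abs_def] ins2_def[abs_def] matrix_mul_assoc matrix_mult_simps)
qed

lemma loop_word_Cons: "loop_word G ((a, \<sigma>) # xs) g = a \<otimes> g [^] \<sigma> \<otimes> loop_word G xs g"
  and loop_word_Nil [simp]: "loop_word G [] g = \<one>"
  by (simp_all add: loop_word_def)

lemma loop_word_append: "loop_word G (xs @ ys) g = loop_word G xs g \<otimes> loop_word G ys g"
  by (induction xs) (auto simp: loop_word_Cons m_assoc)

text \<open>Leibniz rule by induction on the word: the coefficient of the head is constant, its
  power of \<open>g\<close> gives the term \<open>i = 0\<close>, and the tail gives the others with
  indices shifted by one.\<close>

lemma flow_C1_loop_word:
  assumes "\<forall>x\<in>set xs. snd x \<in> {1, - 1}"
  shows "flow_C1 flow (\<lambda>g. \<rho> (loop_word G xs g))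
    (\<lambda>g. \<Sum>i<length xs. \<rho> (loop_word G (take i xs) g \<otimes> fst (xs ! i)) ** ins (snd (xs ! i)) g **
       \<rho> (loop_word G (drop (Suc i) xs) g))"
  using assms
proof (induction xs)
  case Nil
  then show ?case by (simp add: flow_C1_const)
next
  case (Cons x xs)
  obtain a \<sigma> where x: "x = (a, \<sigma>)" by force
  then have \<sigma>: "\<sigma> \<in> {1, - 1}" using Cons.prems by simp
  let ?D = "\<lambda>g. \<Sum>i<length xs. \<rho> (loop_word G (take i xs) g \<otimes> fst (xs ! i)) ** ins (snd (xs ! i)) g **
       \<rho> (loop_word G (drop (Suc i) xs) g)"
  have "flow_C1 flow (\<lambda>g. \<rho> a ** (\<rho> (g [^] \<sigma>) ** \<rho> (loop_word G xs g)))
     (\<lambda>g. \<rho> a ** (ins \<sigma> g ** \<rho> (loop_word G xs g) + \<rho> (g [^] \<sigma>) ** ?D g))"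
    using Cons \<sigma>
    by (intro flow_C1_bounded_linear[OF _
          bounded_bilinear.bounded_linear_right[OF bounded_bilinear_matrix_mult]]
        flow_C1_matrix_mult compact_UNIV flow_C1_rep_int_pow) auto
  moreover have "\<rho> a ** (ins \<sigma> g ** \<rho> (loop_word G xs g) + \<rho> (g [^] \<sigma>) ** ?D g) =
      (\<Sum>i<length (x # xs). \<rho> (loop_word G (take i (x # xs)) g \<otimes> fst ((x # xs) ! i)) **
         ins (snd ((x # xs) ! i)) g ** \<rho> (loop_word G (drop (Suc i) (x # xs)) g))" for g
    unfolding length_Cons sum.lessThan_Suc_shift
    by (simp add: x loop_word_Cons rep_mult matrix_mult_simps matrix_mul_assoc)
  ultimately show ?case by (simp add: x loop_word_Cons rep_mult matrix_mul_assoc)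
qed

section \<open>First and second derivative of a single loop\<close>

context
  fixes l :: "'g loop"
  assumes l: "l \<in> loops G"
begin

lemma loop_sign: "\<forall>x\<in>set l. snd x \<in> {1, - 1}"
  using l by (force simp: loops_def)

text \<open>This is the product that cyclicity of the trace brings in front of the factor at
  \<open>i\<close>: the word after \<open>i\<close>, then the word before it up to its own
  coefficient.\<close>

lemma loop_segment_self:
  assumes "i < length l"
  shows "seg l i i g = \<rho> (loop_word G (drop (Suc i) l) g) ** \<rho> (loop_word G (take i l) g \<otimes> fst (l ! i))"
proof -
  have "(i + length l - i - 1) mod length l = length l - 1" using assms by simp
  moreover have "take (length l - 1) (rotate (Suc i) l) = drop (Suc i) l @ take i l"
    using assms by (simp add: rotate_eq_drop_take take_Suc_conv_app_nth del: rotate_Suc)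
  ultimately show ?thesis
    by (simp add: loop_segment_def loop_word_append rep_mult matrix_mul_assoc del: One_nat_def)
qed

lemma wilson_loop_eq_trace_segment:
  assumes i: "i < length l"
  shows "wilson_loop G \<rho> l g = trace (seg l i i g ** \<rho> (g [^] snd (l ! i)))"
proof -
  have "loop_word G l g = loop_word G (take i l @ l ! i # drop (Suc i) l) g"
    using id_take_nth_drop[OF i] by simp
  also have "\<dots> = loop_word G (take i l) g \<otimes> fst (l ! i) \<otimes> g [^] snd (l ! i) \<otimes> loop_word G (drop (Suc i) l) g"
    using loop_word_Cons[of "fst (l ! i)" "snd (l ! i)"] by (simp add: loop_word_append m_assoc)
  finally have "wilson_loop G \<rho> l g = trace (\<rho> (loop_word G (take i l) g \<otimes> fst (l ! i)) **
      \<rho> (g [^] snd (l ! i)) ** \<rho> (loop_word G (drop (Suc i) l) g))"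
    by (simp add: wilson_loop_def rep_mult)
  then show ?thesis
    by (simp add: loop_segment_self[OF i] trace_mul_sym[of _ "\<rho> (loop_word G (drop (Suc i) l) g)"] matrix_mul_assoc)
qed

definition wilson_D :: "'g \<Rightarrow> complex" where
  "wilson_D g = (\<Sum>j<length l. trace (seg l j j g ** ins (snd (l ! j)) g))"

text \<open>The inner sum comes from two distinct positions, its factors ordered as in
  \<open>twisting_at\<close>; the last term comes from hitting \<open>j\<close> twice.\<close>

definition wilson_DD :: "'g \<Rightarrow> complex" where
  "wilson_DD g = (\<Sum>j<length l.
     (\<Sum>j'\<in>{..<length l} - {j}.
        trace (seg l j' j g ** ins (snd (l ! j)) g ** seg l j j' g ** ins (snd (l ! j')) g)) +
     trace (seg l j j g ** ins2 (snd (l ! j)) g))"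

lemma flow_C1_wilson_loop: "flow_C1 flow (wilson_loop G \<rho> l) wilson_D"
proof -
  have "flow_C1 flow (\<lambda>g. trace (\<rho> (loop_word G l g)))
    (\<lambda>g. trace (\<Sum>i<length l. \<rho> (loop_word G (take i l) g \<otimes> fst (l ! i)) ** ins (snd (l ! i)) g **
       \<rho> (loop_word G (drop (Suc i) l) g)))"
    by (rule flow_C1_bounded_linear[OF flow_C1_loop_word[OF loop_sign] bounded_linear_trace])
  moreover have "trace (\<rho> (loop_word G (take i l) g \<otimes> fst (l ! i)) ** ins (snd (l ! i)) g **
      \<rho> (loop_word G (drop (Suc i) l) g)) = trace (seg l i i g ** ins (snd (l ! i)) g)"
    if "i < length l" for i g
    using that
    by (simp add: loop_segment_self trace_mul_sym[of _ "\<rho> (loop_word G (drop (Suc i) l) g)"] matrix_mul_assoc)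
  ultimately show ?thesis
    by (simp add: wilson_D_def[abs_def] wilson_loop_def[abs_def] trace_sum)
qed

text \<open>Cut open after \<open>j\<close>, the loop is a linear word in the other positions, to
  which the Leibniz rule for words applies. Differentiating at \<open>j'\<close> splits it into the
  segments from \<open>j\<close> to \<open>j'\<close> and from \<open>j'\<close> to
  \<open>j\<close>.\<close>

lemma flow_C1_loop_segment:
  assumes j: "j < length l"
  shows "flow_C1 flow (seg l j j)
    (\<lambda>g. \<Sum>j'\<in>{..<length l} - {j}. seg l j j' g ** ins (snd (l ! j')) g ** seg l j' j g)"
proof -
  let ?n = "length l"
  \<comment> \<open>\<open>r\<close> lists the positions cyclically after \<open>j\<close> and ends
    with \<open>j\<close> itself. \<open>xs\<close> drops this last letter, whose coefficient
    remains as a constant matrix on the right.\<close>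
  define r where "r = rotate (Suc j) l"
  define xs where "xs = take (?n - 1) r"
  have lens: "length r = ?n" "length xs = ?n - 1" by (simp_all add: r_def xs_def)
  have xs_sign: "\<forall>x\<in>set xs. snd x \<in> {1, - 1}"
  proof -
    have "set xs \<subseteq> set l" using set_take_subset[of _ r] by (simp add: xs_def r_def)
    with loop_sign show ?thesis by blast
  qed
  have "(j + ?n - j - 1) mod ?n = ?n - 1" using j by simp
  then have seg: "seg l j j = (\<lambda>g. \<rho> (loop_word G xs g) ** \<rho> (fst (l ! j)))"
    by (simp add: loop_segment_def[abs_def] xs_def r_def rep_mult del: One_nat_def)
  have "flow_C1 flow (\<lambda>g. \<rho> (loop_word G xs g) ** \<rho> (fst (l ! j)))
     (\<lambda>g. (\<Sum>i<length xs. \<rho> (loop_word G (take i xs) g \<otimes> fst (xs ! i)) ** ins (snd (xs ! i)) g **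
        \<rho> (loop_word G (drop (Suc i) xs) g)) ** \<rho> (fst (l ! j)))"
    by (rule flow_C1_bounded_linear[OF flow_C1_loop_word[OF xs_sign]
        bounded_bilinear.bounded_linear_left[OF bounded_bilinear_matrix_mult]])
  moreover have "(\<Sum>i<length xs. \<rho> (loop_word G (take i xs) g \<otimes> fst (xs ! i)) ** ins (snd (xs ! i)) g **
        \<rho> (loop_word G (drop (Suc i) xs) g)) ** \<rho> (fst (l ! j)) =
      (\<Sum>j'\<in>{..<length l} - {j}. seg l j j' g ** ins (snd (l ! j')) g ** seg l j' j g)" for g
  proof -
    have "\<rho> (loop_word G (take i xs) g \<otimes> fst (xs ! i)) ** ins (snd (xs ! i)) g **
        \<rho> (loop_word G (drop (Suc i) xs) g) ** \<rho> (fst (l ! j)) =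
        seg l j ((Suc j + i) mod ?n) g ** ins (snd (l ! ((Suc j + i) mod ?n))) g ** seg l ((Suc j + i) mod ?n) j g"
      if i: "i < ?n - 1" for i
    proof -
      define j' where "j' = (Suc j + i) mod ?n"
      note m = mod_cyclic_between[OF i j j'_def]
      have nth: "xs ! i = l ! j'"
        using i by (simp add: xs_def r_def j'_def nth_rotate del: rotate_Suc)
      have 1: "seg l j j' g = \<rho> (loop_word G (take i xs) g \<otimes> fst (xs ! i))"
      proof -
        have "take i xs = take i (rotate (Suc j) l)"
          using i by (simp add: xs_def r_def min_def del: rotate_Suc)
        then show ?thesis by (simp only: loop_segment_def m(3) nth)
      qed
      have "rotate (Suc j') l = rotate (Suc i) r"
      proof -
        have "rotate (Suc j') l = rotate (Suc (Suc j + i)) l"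
          using rotate_conv_mod[of "Suc j'" l] rotate_conv_mod[of "Suc (Suc j + i)" l]
          unfolding j'_def mod_Suc_eq by simp
        also have "\<dots> = rotate (Suc i) r"
          unfolding r_def rotate_rotate by (simp add: add.commute)
        finally show ?thesis .
      qed
      also have "\<dots> = drop (Suc i) r @ take (Suc i) r"
        using i lens by (intro rotate_eq_drop_take) simp
      \<comment> \<open>\<open>drop (Suc i) r\<close> has one letter more than are taken, so there
        is no wrap-around, and the omitted letter is position \<open>j\<close>.\<close>
      finally have "take (?n - 2 - i) (rotate (Suc j') l) = take (?n - 2 - i) (drop (Suc i) r)"
        using i lens by simp
      also have "\<dots> = drop (Suc i) xs"
        using i by (simp add: xs_def drop_take numeral_2_eq_2)
      finally have 2: "seg l j' j g = \<rho> (loop_word G (drop (Suc i) xs) g) ** \<rho> (fst (l ! j))"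
        using m(4) by (simp add: loop_segment_def rep_mult del: rotate_Suc)
      show ?thesis
        unfolding j'_def[symmetric] 1 2 nth by (simp add: matrix_mul_assoc)
    qed
    then show ?thesis
      unfolding lens matrix_mult_simps
      by (intro sum.reindex_bij_betw[OF bij_betw_cyclic_shift[OF j], THEN trans[rotated]] sum.cong) auto
  qed
  ultimately show ?thesis by (simp add: seg)
qed

text \<open>The product rule on segment times insertion separates the hits on other positions from
  the second hit on \<open>j\<close>. Cyclicity of the trace then brings the former into the order
  of \<open>twisting_at\<close>.\<close>

lemma flow_C1_wilson_D: "flow_C1 flow wilson_D wilson_DD"
proof -
  have "flow_C1 flow (\<lambda>g. \<Sum>j<length l. trace (seg l j j g ** ins (snd (l ! j)) g))
    (\<lambda>g. \<Sum>j<length l. trace (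
      (\<Sum>j'\<in>{..<length l} - {j}. seg l j j' g ** ins (snd (l ! j')) g ** seg l j' j g) ** ins (snd (l ! j)) g +
      seg l j j g ** ins2 (snd (l ! j)) g))"
    by (intro flow_C1_sum flow_C1_bounded_linear[OF _ bounded_linear_trace] flow_C1_matrix_mult
        flow_C1_loop_segment flow_C1_ins compact_UNIV) auto
  moreover have "trace (X ** Y ** Z ** T) = trace (Z ** T ** X ** Y)" for X Y Z T :: "complex ^ 'n ^ 'n"
    using trace_mul_sym[of "X ** Y" "Z ** T"] by (simp add: matrix_mul_assoc)
  ultimately show ?thesis
    by (simp add: wilson_D_def[abs_def] wilson_DD_def[abs_def] trace_add trace_sum matrix_mult_simps)
qed

end

section \<open>Integration by parts against the density\<close>

lemma integral_by_parts_twice: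
  fixes F :: "'g \<Rightarrow> complex"
  assumes M: "normalized_haar G M" and F: "flow_C1 flow F F1" "flow_C1 flow F1 F2"
    and \<nu>: "Ck_map 2 A vector_space_atlas (\<nu> :: 'g \<Rightarrow> real)"
  shows "(\<integral>g. F2 g * of_real (\<nu> g) \<partial>M) =
    (\<integral>g. F g * of_real (left_inv_field G c v (left_inv_field G c v \<nu>) g) \<partial>M)"
proof -
  define N where "N = (\<lambda>g. complex_of_real (\<nu> g))"
  define N1 where "N1 = (\<lambda>g. complex_of_real (left_inv_field G c v \<nu> g))"
  define N2 where "N2 = (\<lambda>g. complex_of_real (left_inv_field G c v (left_inv_field G c v \<nu>) g))"
  \<comment> \<open>Each field derivative costs one order, so the second one of \<nu> is merely
    continuous; \<open>flow_C1\<close> asks no more of a derivative.\<close>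
  have \<nu>2: "Ck_map (Suc (Suc 0)) A vector_space_atlas \<nu>" using \<nu> by (simp add: numeral_2_eq_2)
  have N: "flow_C1 flow N N1" unfolding N_def N1_def
    by (rule flow_C1_bounded_linear[OF flow_C1_left_inv_field[OF \<nu>2] bounded_linear_of_real])
  have N1: "flow_C1 flow N1 N2" unfolding N1_def N2_def
    by (rule flow_C1_bounded_linear[OF flow_C1_left_inv_field[OF Ck_map_left_inv_field[OF \<nu>2]]
        bounded_linear_of_real])
  have fin: "finite_measure M" and sets: "sets M = sets borel"
    using M by (auto simp: normalized_haar_def prob_space_def)
  note int = integrable_continuous_compact[OF compact_UNIV fin sets]
  have ibp: "(\<integral>g. u' g * w g \<partial>M) = - (\<integral>g. u g * w' g \<partial>M)"
    if "flow_C1 flow u u'" "flow_C1 flow w w'" for u u' w w' :: "'g \<Rightarrow> complex"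
  proof -
    note uw = flow_C1_mult[OF compact_UNIV that]
    have "(\<integral>g. u' g * w g + u g * w' g \<partial>M) = 0"
      using haar_right_invariant[OF M flow_C1_continuous(1)[OF uw]]
      by (intro integral_flow_derivative[OF compact_UNIV fin sets continuous_flow _ uw])
        (simp add: flow_def)
    moreover have "integrable M (\<lambda>g. u' g * w g)" "integrable M (\<lambda>g. u g * w' g)"
      using that by (auto intro!: int continuous_intros dest: flow_C1_continuous)
    ultimately show ?thesis by (simp add: eq_neg_iff_add_eq_0)
  qed
  have "(\<integral>g. F2 g * N g \<partial>M) = (\<integral>g. F g * N2 g \<partial>M)"
    using ibp[OF F(2) N] ibp[OF F(1) N1] by simp
  then show ?thesis by (simp add: N_def N2_def)
qed

end

section \<open>The Schwinger--Dyson equation\<close>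

lemma mat_mult_commute: "mat a ** (X :: complex ^ 'n ^ 'n) = X ** mat a"
  by (simp add: vec_eq_iff matrix_matrix_mult_def mat_def if_distrib if_distribR mult.commute
      cong: if_cong)

lemma trace_mult_mat: "trace ((X :: complex ^ 'n ^ 'n) ** mat a) = a * trace X"
  by (simp add: trace_def matrix_matrix_mult_def mat_def if_distrib if_distribR mult.commute
      sum_distrib_left cong: if_cong)

lemma sum_symmetric_off_diagonal:
  fixes a :: "nat \<Rightarrow> nat \<Rightarrow> 'a::comm_semiring_1"
  assumes "\<And>r s. a r s = a s r"
  shows "(\<Sum>r=m..n. \<Sum>s\<in>{m..n} - {r}. a r s) = 2 * (\<Sum>r=m..n. \<Sum>s\<in>{r<..n}. a r s)"
proof -
  have split: "(\<Sum>s\<in>{m..n} - {r}. a r s) = (\<Sum>s\<in>{r<..n}. a r s) + (\<Sum>s | s \<in> {m..n} \<and> s < r. a r s)"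
    if "r \<in> {m..n}" for r
  proof -
    have "{m..n} - {r} = {r<..n} \<union> {s. s \<in> {m..n} \<and> s < r}" using that by auto
    moreover have "{r<..n} \<inter> {s. s \<in> {m..n} \<and> s < r} = {}" by auto
    ultimately show ?thesis by (simp add: sum.union_disjoint)
  qed
  have "(\<Sum>r=m..n. \<Sum>s | s \<in> {m..n} \<and> s < r. a r s) = (\<Sum>s=m..n. \<Sum>r | r \<in> {m..n} \<and> s < r. a r s)"
    by (rule sum.swap_restrict) auto
  also have "\<dots> = (\<Sum>s=m..n. \<Sum>r\<in>{s<..n}. a s r)"
    using assms by (intro sum.cong) auto
  finally show ?thesis
    using split by (simp add: sum.distrib mult_2)
qed

context rep_direction
begin

text \<open>Kept to one direction: neither the second derivatives of one loop nor the ordered pairs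
  of distinct loops become twistings or mergers before the sum over the basis is taken.\<close>

lemma integral_wilson_loops_by_parts:
  assumes M: "normalized_haar G M" and \<nu>: "Ck_map 2 A vector_space_atlas (\<nu> :: 'g \<Rightarrow> real)"
    and I: "finite I" and l: "\<And>r. r \<in> I \<Longrightarrow> l r \<in> loops G"
  shows "(\<integral>g. (\<Sum>r\<in>I. wilson_DD (l r) g * (\<Prod>k\<in>I - {r}. wilson_loop G \<rho> (l k) g) +
            (\<Sum>s\<in>I - {r}. wilson_D (l r) g * wilson_D (l s) g * (\<Prod>k\<in>I - {r, s}. wilson_loop G \<rho> (l k) g))) *
            of_real (\<nu> g) \<partial>M) =
    (\<integral>g. (\<Prod>k\<in>I. wilson_loop G \<rho> (l k) g) *
       of_real (left_inv_field G c v (left_inv_field G c v \<nu>) g) \<partial>M)"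
proof (rule integral_by_parts_twice[OF M _ _ \<nu>])
  let ?W = "\<lambda>k. wilson_loop G \<rho> (l k)"
  show "flow_C1 flow (\<lambda>g. \<Prod>k\<in>I. ?W k g) (\<lambda>g. \<Sum>r\<in>I. wilson_D (l r) g * (\<Prod>k\<in>I - {r}. ?W k g))"
    by (intro flow_C1_prod compact_UNIV flow_0 I flow_C1_wilson_loop l)
  have "flow_C1 flow (\<lambda>g. \<Sum>r\<in>I. wilson_D (l r) g * (\<Prod>k\<in>I - {r}. ?W k g))
    (\<lambda>g. \<Sum>r\<in>I. wilson_DD (l r) g * (\<Prod>k\<in>I - {r}. ?W k g) +
       wilson_D (l r) g * (\<Sum>s\<in>I - {r}. wilson_D (l s) g * (\<Prod>k\<in>I - {r} - {s}. ?W k g)))"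
    using I l
    by (intro flow_C1_sum flow_C1_mult flow_C1_prod compact_UNIV flow_0 flow_C1_wilson_loop flow_C1_wilson_D) auto
  moreover have "I - {r} - {s} = I - {r, s}" for r s by auto
  ultimately show "flow_C1 flow (\<lambda>g. \<Sum>r\<in>I. wilson_D (l r) g * (\<Prod>k\<in>I - {r}. ?W k g))
    (\<lambda>g. \<Sum>r\<in>I. wilson_DD (l r) g * (\<Prod>k\<in>I - {r}. ?W k g) +
       (\<Sum>s\<in>I - {r}. wilson_D (l r) g * wilson_D (l s) g * (\<Prod>k\<in>I - {r, s}. ?W k g)))"
    by (simp add: sum_distrib_left mult.assoc)
qed

lemma continuous_on_wilson:
  assumes "l \<in> loops G"
  shows "continuous_on UNIV (wilson_loop G \<rho> l)" "continuous_on UNIV (wilson_D l)"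
    "continuous_on UNIV (wilson_DD l)"
  using flow_C1_continuous[OF flow_C1_wilson_loop[OF assms]] flow_C1_continuous[OF flow_C1_wilson_D[OF assms]]
  by auto

end

section \<open>Summation over the basis\<close>

locale compact_lie_group_rep = compact_lie_group G A
  for G :: "('g::{t2_space, second_countable_topology}, 'm) monoid_scheme" (structure)
    and A :: "('g, 'e::real_inner) chart set" +
  fixes c :: "('g, 'e) chart" and \<rho> :: "'g \<Rightarrow> complex ^ 'n ^ 'n"
  assumes c_in_atlas: "c \<in> A" and one_in_c: "\<one> \<in> fst c" and rep: "lie_group_rep G A \<rho>"
begin

text \<open>The locale \<open>rep_direction\<close> fixes one vector, but its predicate does not
  mention it, so this single fact serves every \<xi> in the basis sums.\<close>

lemma rep_direction: "rep_direction G A c \<rho>"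
  by unfold_locales (use c_in_atlas one_in_c rep in auto)

abbreviation D where "D \<xi> \<equiv> rep_direction.wilson_D G c \<xi> \<rho>"

abbreviation DD where "DD \<xi> \<equiv> rep_direction.wilson_DD G c \<xi> \<rho>"

text \<open>Expanding the product of the two first derivatives gives one term per pair of positions.
  Commutativity of this product is also the source of the symmetry of the merger.\<close>

lemma sum_D_mult_D:
  assumes "l \<in> loops G" "l' \<in> loops G"
  shows "(\<Sum>\<xi>\<in>B. D \<xi> l g * D \<xi> l' g) = total_merger G c B \<rho> l l' g"
proof -
  have "(\<Sum>\<xi>\<in>B. D \<xi> l g * D \<xi> l' g) = (\<Sum>\<xi>\<in>B. \<Sum>j<length l. \<Sum>j'<length l'.
      trace (loop_segment G \<rho> l j j g ** insertion G c \<rho> \<xi> (snd (l ! j)) g) *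
      trace (loop_segment G \<rho> l' j' j' g ** insertion G c \<rho> \<xi> (snd (l' ! j')) g))"
    using assms by (simp add: rep_direction.wilson_D_def[OF rep_direction] sum_product)
  also have "\<dots> = total_merger G c B \<rho> l l' g"
    unfolding total_merger_def merger_at_def
    by (subst sum.swap, rule sum.cong[OF refl], rule sum.swap)
  finally show ?thesis .
qed

lemma total_merger_commute:
  assumes "l \<in> loops G" "l' \<in> loops G"
  shows "total_merger G c B \<rho> l l' g = total_merger G c B \<rho> l' l g"
  using assms by (simp add: sum_D_mult_D[symmetric] mult.commute)

text \<open>The off-diagonal terms are the twisting after exchanging sums. In the diagonal ones
  linearity of the trace lets the basis sum act on \<open>ins2\<close> alone, where it becomes
  multiplication by \<open>cas\<close>.\<close>

lemma sum_DD:
  assumes l: "l \<in> loops G" and cas: "casimir_rep G c B \<rho> = mat cas"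
  shows "(\<Sum>\<xi>\<in>B. DD \<xi> l g) =
    total_twisting G c B \<rho> l g + cas * of_nat (length l) * wilson_loop G \<rho> l g"
proof -
  have "(\<Sum>\<xi>\<in>B. trace (loop_segment G \<rho> l j j g ** rep_direction.ins2 G c \<xi> \<rho> (snd (l ! j)) g)) =
      cas * wilson_loop G \<rho> l g" if j: "j < length l" for j
  proof -
    let ?\<sigma> = "snd (l ! j)" and ?S = "loop_segment G \<rho> l j j g"
    have \<sigma>: "?\<sigma> \<in> {1, - 1}"
      using l nth_mem[OF j] by (force simp: loops_def)
    have "(\<Sum>\<xi>\<in>B. rep_direction.ins2 G c \<xi> \<rho> ?\<sigma> g) = \<rho> (g [^] ?\<sigma>) ** mat cas"
    proof (cases "?\<sigma> = 1")
      case True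
      then show ?thesis
        by (simp add: rep_direction.ins2_def[OF rep_direction] cas[symmetric] casimir_rep_def matrix_mult_simps)
    next
      case False
      then have "?\<sigma> = - 1" using \<sigma> by simp
      then show ?thesis
        \<comment> \<open>For the inverse the Casimir matrix arises on the left of the power of
          \<open>g\<close>; being scalar, it may be written on either side.\<close>
        unfolding mat_mult_commute[symmetric]
        by (simp add: rep_direction.ins2_def[OF rep_direction] cas[symmetric]
            casimir_rep_def matrix_mult_simps rep_direction.int_pow_minus_one[OF rep_direction])
    qed
    then have "(\<Sum>\<xi>\<in>B. trace (?S ** rep_direction.ins2 G c \<xi> \<rho> ?\<sigma> g)) = trace (?S ** \<rho> (g [^] ?\<sigma>) ** mat cas)"
      by (simp add: trace_sum[symmetric] matrix_mult_simps[symmetric] matrix_mul_assoc)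
    also have "\<dots> = cas * wilson_loop G \<rho> l g"
      by (simp add: trace_mult_mat rep_direction.wilson_loop_eq_trace_segment[OF rep_direction l j])
    finally show ?thesis .
  qed
  then have diag: "(\<Sum>j<length l. \<Sum>\<xi>\<in>B. trace (loop_segment G \<rho> l j j g ** rep_direction.ins2 G c \<xi> \<rho> (snd (l ! j)) g)) =
      cas * of_nat (length l) * wilson_loop G \<rho> l g"
    by simp
  have "(\<Sum>\<xi>\<in>B. DD \<xi> l g) =
    (\<Sum>j<length l. \<Sum>\<xi>\<in>B. \<Sum>j'\<in>{..<length l} - {j}.
        trace (loop_segment G \<rho> l j' j g ** insertion G c \<rho> \<xi> (snd (l ! j)) g **
          loop_segment G \<rho> l j j' g ** insertion G c \<rho> \<xi> (snd (l ! j')) g)) +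
    (\<Sum>j<length l. \<Sum>\<xi>\<in>B. trace (loop_segment G \<rho> l j j g ** rep_direction.ins2 G c \<xi> \<rho> (snd (l ! j)) g))"
    unfolding rep_direction.wilson_DD_def[OF rep_direction l] sum.distrib
    by (intro arg_cong2[where f="(+)"] sum.swap)
  also have "(\<Sum>j<length l. \<Sum>\<xi>\<in>B. \<Sum>j'\<in>{..<length l} - {j}.
        trace (loop_segment G \<rho> l j' j g ** insertion G c \<rho> \<xi> (snd (l ! j)) g **
          loop_segment G \<rho> l j j' g ** insertion G c \<rho> \<xi> (snd (l ! j')) g)) = total_twisting G c B \<rho> l g"
    unfolding total_twisting_def twisting_at_def by (intro sum.cong[OF refl] sum.swap)
  finally show ?thesis using diag by simp
qed

text \<open>The basis sum equates the Laplacian integral with the Casimir term plus the twistings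
  plus twice the mergers; the minus signs come from solving for the Casimir term.\<close>

theorem wilson_loop_equation:
  fixes q :: nat
  assumes M: "normalized_haar G M" and \<nu>: "Ck_map 2 A vector_space_atlas (\<nu> :: 'g \<Rightarrow> real)"
    and B: "finite B" and l: "\<And>r. r \<in> {1..q} \<Longrightarrow> l r \<in> loops G"
    and cas: "casimir_rep G c B \<rho> = mat cas"
  shows "cas * (\<Sum>r=1..q. of_nat (length (l r))) *
           (\<integral>g. (\<Prod>k=1..q. wilson_loop G \<rho> (l k) g) * of_real (\<nu> g) \<partial>M) =
         - 2 * (\<Sum>r=1..q. \<Sum>s\<in>{r<..q}.
             \<integral>g. total_merger G c B \<rho> (l r) (l s) g *
               (\<Prod>k\<in>{1..q} - {r, s}. wilson_loop G \<rho> (l k) g) * of_real (\<nu> g) \<partial>M)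
         - (\<Sum>r=1..q.
             \<integral>g. total_twisting G c B \<rho> (l r) g *
               (\<Prod>k\<in>{1..q} - {r}. wilson_loop G \<rho> (l k) g) * of_real (\<nu> g) \<partial>M)
         + (\<integral>g. (\<Prod>k=1..q. wilson_loop G \<rho> (l k) g) * of_real (laplacian G c B \<nu> g) \<partial>M)"
proof -
  let ?I = "{1..q}" and ?W = "\<lambda>k. wilson_loop G \<rho> (l k)"
  let ?P = "\<lambda>S g. \<Prod>k\<in>S. ?W k g" and ?N = "\<lambda>g. complex_of_real (\<nu> g)"
  let ?M = "\<lambda>r s. total_merger G c B \<rho> (l r) (l s)" and ?T = "\<lambda>r. total_twisting G c B \<rho> (l r)"
  let ?LL = "\<lambda>\<xi>. left_inv_field G c \<xi> (left_inv_field G c \<xi> \<nu>)"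
  let ?E = "\<lambda>\<xi> g. (\<Sum>r\<in>?I. DD \<xi> (l r) g * ?P (?I - {r}) g +
      (\<Sum>s\<in>?I - {r}. D \<xi> (l r) g * D \<xi> (l s) g * ?P (?I - {r, s}) g)) * ?N g"
  have fin: "finite_measure M" and sets: "sets M = sets borel"
    using M by (auto simp: normalized_haar_def prob_space_def)
  note int = integrable_continuous_compact[OF compact_UNIV fin sets]
  have \<nu>2: "Ck_map (Suc (Suc 0)) A vector_space_atlas \<nu>" using \<nu> by (simp add: numeral_2_eq_2)
  have dir: "lie_algebra_direction G A c"
    by unfold_locales (use c_in_atlas one_in_c in auto)
  note Ck_field = lie_algebra_direction.Ck_map_left_inv_field[OF dir]
  have cLL: "continuous_on UNIV (?LL \<xi>)" for \<xi>
    using Ck_field[OF Ck_field[OF \<nu>2]] by (simp add: Ck_map_def)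
  have cN: "continuous_on UNIV ?N"
    using \<nu> by (auto simp: Ck_map_def intro: continuous_intros)
  note cW = rep_direction.continuous_on_wilson[OF rep_direction l]
  have cP: "continuous_on UNIV (?P S)" if "S \<subseteq> ?I" for S
    using that by (intro continuous_on_prod cW) auto
  have cM: "continuous_on UNIV (?M r s)" if "r \<in> ?I" "s \<in> ?I" for r s
    unfolding sum_D_mult_D[OF l[OF that(1)] l[OF that(2)], symmetric, abs_def]
    using that by (intro continuous_on_sum continuous_on_mult cW) auto
  \<comment> \<open>The twisting is continuous as the difference of the summed second derivatives
    and the Casimir term, both already known to be continuous.\<close>
  have cT: "continuous_on UNIV (?T r)" if "r \<in> ?I" for r
  proof -
    have "?T r = (\<lambda>g. (\<Sum>\<xi>\<in>B. DD \<xi> (l r) g) - cas * of_nat (length (l r)) * ?W r g)"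
      by (simp add: sum_DD[OF l[OF that] cas])
    then show ?thesis
      using that by (auto intro!: continuous_intros cW)
  qed
  have by_parts: "(\<integral>g. ?E \<xi> g \<partial>M) = (\<integral>g. ?P ?I g * of_real (?LL \<xi> g) \<partial>M)" for \<xi>
    by (rule rep_direction.integral_wilson_loops_by_parts[OF rep_direction M \<nu> _ l]) auto
  have intE: "integrable M (?E \<xi>)" for \<xi>
    by (rule int) (intro continuous_on_mult continuous_on_sum continuous_on_add cN cP cW; auto)
  have intL: "integrable M (\<lambda>g. ?P ?I g * of_real (?LL \<xi> g))" for \<xi>
    by (rule int) (intro continuous_on_mult continuous_on_of_real cP cLL; auto)
  have intT: "integrable M (\<lambda>g. ?T r g * ?P (?I - {r}) g * ?N g)" if "r \<in> ?I" for r
    using that by (intro int continuous_on_mult cT cP cN) auto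
  have intM: "integrable M (\<lambda>g. ?M r s g * ?P (?I - {r, s}) g * ?N g)" if "r \<in> ?I" "s \<in> ?I" for r s
    using that by (intro int continuous_on_mult cM cP cN) auto
  have intW: "integrable M (\<lambda>g. ?P ?I g * ?N g)"
    by (intro int continuous_on_mult cP cN) auto
  have pointwise: "(\<Sum>\<xi>\<in>B. ?E \<xi> g) = (\<Sum>r\<in>?I. ?T r g * ?P (?I - {r}) g * ?N g +
      cas * of_nat (length (l r)) * (?P ?I g * ?N g) +
      (\<Sum>s\<in>?I - {r}. ?M r s g * ?P (?I - {r, s}) g * ?N g))" for g
  proof -
    have "(\<Sum>\<xi>\<in>B. ?E \<xi> g) = (\<Sum>r\<in>?I. (\<Sum>\<xi>\<in>B. DD \<xi> (l r) g) * ?P (?I - {r}) g +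
        (\<Sum>s\<in>?I - {r}. (\<Sum>\<xi>\<in>B. D \<xi> (l r) g * D \<xi> (l s) g) * ?P (?I - {r, s}) g)) * ?N g"
    proof -
      have "(\<Sum>\<xi>\<in>B. \<Sum>s\<in>?I - {r}. D \<xi> (l r) g * D \<xi> (l s) g * ?P (?I - {r, s}) g) =
          (\<Sum>s\<in>?I - {r}. (\<Sum>\<xi>\<in>B. D \<xi> (l r) g * D \<xi> (l s) g) * ?P (?I - {r, s}) g)" for r
        by (subst sum.swap) (simp only: sum_distrib_right)
      then show ?thesis
        unfolding sum_distrib_right[symmetric]
        by (subst sum.swap) (simp only: sum.distrib sum_distrib_right[symmetric])
    qed
    also have "\<dots> = (\<Sum>r\<in>?I. (?T r g + cas * of_nat (length (l r)) * ?W r g) * ?P (?I - {r}) g +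
        (\<Sum>s\<in>?I - {r}. ?M r s g * ?P (?I - {r, s}) g)) * ?N g"
      by (intro arg_cong2[where f="(*)"] arg_cong2[where f="(+)"] sum.cong refl sum_DD sum_D_mult_D cas l) auto
    also have "\<dots> = (\<Sum>r\<in>?I. ?T r g * ?P (?I - {r}) g * ?N g +
        cas * of_nat (length (l r)) * ((?W r g * ?P (?I - {r}) g) * ?N g) +
        (\<Sum>s\<in>?I - {r}. ?M r s g * ?P (?I - {r, s}) g * ?N g))"
      by (simp only: sum_distrib_right distrib_right) (simp only: mult_ac)
    \<comment> \<open>The Casimir term returns the loop \<open>r\<close> itself, which completes the
      product over \<open>?I - {r}\<close> to the full one.\<close>
    also have "\<dots> = (\<Sum>r\<in>?I. ?T r g * ?P (?I - {r}) g * ?N g +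
        cas * of_nat (length (l r)) * (?P ?I g * ?N g) +
        (\<Sum>s\<in>?I - {r}. ?M r s g * ?P (?I - {r, s}) g * ?N g))"
      by (intro sum.cong refl arg_cong2[where f="(+)"] arg_cong2[where f="(*)"] prod.remove[symmetric]) auto
    finally show ?thesis .
  qed
  have "(\<integral>g. ?P ?I g * of_real (laplacian G c B \<nu> g) \<partial>M) = (\<integral>g. (\<Sum>\<xi>\<in>B. ?P ?I g * of_real (?LL \<xi> g)) \<partial>M)"
    by (simp add: laplacian_def sum_distrib_left)
  also have "\<dots> = (\<Sum>\<xi>\<in>B. \<integral>g. ?E \<xi> g \<partial>M)"
    using intL by (simp only: Bochner_Integration.integral_sum by_parts)
  also have "\<dots> = (\<integral>g. (\<Sum>\<xi>\<in>B. ?E \<xi> g) \<partial>M)"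
    using intE by (simp only: Bochner_Integration.integral_sum)
  also have "\<dots> = (\<Sum>r\<in>?I. (\<integral>g. ?T r g * ?P (?I - {r}) g * ?N g \<partial>M) +
      cas * of_nat (length (l r)) * (\<integral>g. ?P ?I g * ?N g \<partial>M) +
      (\<Sum>s\<in>?I - {r}. \<integral>g. ?M r s g * ?P (?I - {r, s}) g * ?N g \<partial>M))"
    unfolding pointwise
    by (rule has_bochner_integral_integral_eq, intro has_bochner_integral_sum has_bochner_integral_add
        has_bochner_integral_mult_right has_bochner_integral_integrable intT intM intW) auto
  also have "\<dots> = (\<Sum>r\<in>?I. \<integral>g. ?T r g * ?P (?I - {r}) g * ?N g \<partial>M) +
      cas * (\<Sum>r\<in>?I. of_nat (length (l r))) * (\<integral>g. ?P ?I g * ?N g \<partial>M) +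
      (\<Sum>r\<in>?I. \<Sum>s\<in>?I - {r}. \<integral>g. ?M r s g * ?P (?I - {r, s}) g * ?N g \<partial>M)"
    by (simp add: sum.distrib sum_distrib_left sum_distrib_right)
  also have "(\<Sum>r\<in>?I. \<Sum>s\<in>?I - {r}. \<integral>g. ?M r s g * ?P (?I - {r, s}) g * ?N g \<partial>M) =
      2 * (\<Sum>r\<in>?I. \<Sum>s\<in>{r<..q}. \<integral>g. ?M r s g * ?P (?I - {r, s}) g * ?N g \<partial>M)"
  proof -
    \<comment> \<open>Symmetry of the merger is known only for admissible loops, that is for indices
      in \<open>{1..q}\<close>; the value 0 elsewhere makes \<open>a\<close> symmetric for all
      indices, as the summation lemma requires.\<close>
    define a where "a r s = (if r \<in> ?I \<and> s \<in> ?I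
      then \<integral>g. ?M r s g * ?P (?I - {r, s}) g * ?N g \<partial>M else 0)" for r s
    have "a r s = a s r" for r s
      using total_merger_commute[OF l l, of r s] by (simp add: a_def insert_commute)
    from sum_symmetric_off_diagonal[of a, OF this, of 1 q] show ?thesis
      by (simp add: a_def cong: sum.cong_simp)
  qed
  finally show ?thesis by (simp add: algebra_simps)
qed

end

theorem theorem3p6:
  fixes G :: "('g::{t2_space, second_countable_topology}, 'm) monoid_scheme"
    and A :: "('g, 'e::real_inner) chart set"
    and c :: "('g, 'e) chart"
    and dg :: "'g measure"
    and \<kappa> :: "'e \<Rightarrow> 'e \<Rightarrow> real"
    and B :: "'e set"
    and \<nu> :: "'g \<Rightarrow> real"
    and \<rho> :: "'g \<Rightarrow> complex ^ 'n ^ 'n"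
    and q :: nat
    and l :: "nat \<Rightarrow> 'g loop"
    and cas :: complex
  assumes "compact_lie_group G A"
    and "c \<in> A" and "\<one>\<^bsub>G\<^esub> \<in> fst c"
    and "normalized_haar G dg"
    and "Ad_invariant_inner G c \<kappa>"
    and "orthonormal_basis \<kappa> B"
    and "\<And>g. \<nu> g \<ge> 0" and "(\<integral>g. \<nu> g \<partial>dg) = 1" and "Ck_map 2 A vector_space_atlas \<nu>"
    and "lie_group_rep G A \<rho>" and "irreducible_rep G \<rho>"
    and "\<And>r. r \<in> {1..q} \<Longrightarrow> l r \<in> loops G"
    and "casimir_rep G c B \<rho> = mat cas"
  shows "cas * (\<Sum>r=1..q. of_nat (length (l r))) *
           (\<integral>g. (\<Prod>k=1..q. wilson_loop G \<rho> (l k) g) * of_real (\<nu> g) \<partial>dg) =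
         - 2 * (\<Sum>r=1..q. \<Sum>s\<in>{r<..q}.
             \<integral>g. total_merger G c B \<rho> (l r) (l s) g *
               (\<Prod>k\<in>{1..q} - {r, s}. wilson_loop G \<rho> (l k) g) * of_real (\<nu> g) \<partial>dg)
         - (\<Sum>r=1..q.
             \<integral>g. total_twisting G c B \<rho> (l r) g *
               (\<Prod>k\<in>{1..q} - {r}. wilson_loop G \<rho> (l k) g) * of_real (\<nu> g) \<partial>dg)
         + (\<integral>g. (\<Prod>k=1..q. wilson_loop G \<rho> (l k) g) * of_real (laplacian G c B \<nu> g) \<partial>dg)"
proof -
  have "compact_lie_group_rep G A c \<rho>"
    using assms(1-3,10) by (simp add: compact_lie_group_rep_def compact_lie_group_rep_axioms_def)
  moreover have "finite B" using assms(6) by (simp add: orthonormal_basis_def)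
  ultimately show ?thesis
    using assms by (intro compact_lie_group_rep.wilson_loop_equation[where A = A]) auto
qed

end
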